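(* Let $\rho$ be an $(\mathcal{F}_t)$ pseudo-stopping time with $\mathbb{P}[\rho=\infty]=0$, and let $A_t^\rho$ be the $(\mathcal{F}_t)$-dual optional projection of the process $1_{\{\rho\le t\}}$. Then the Föllmer measure $\mu$ associated with $A^\rho$, that is, $\mu(X)=\mathbb{E}\big[\int_{[0,\infty)}X_s\,dA_s^\rho\big]$ for bounded or nonnegative $\mathcal{B}([0,\infty])\otimes\mathcal{F}$-measurable processes $X$, is a randomized stopping time. Moreover, for every bounded or nonnegative $(\mathcal{F}_t)$-optional process $(X_t)$, $$\mu(X)=\mathbb{E}[X_\rho].$$
   Context: $(\Omega,\mathcal{F},(\mathcal{F}_t)_{t\ge0},\mathbb{P})$ is a filtered probability space satisfying the usual conditions; martingales are taken càdlàg. A random time is an $\mathcal{F}$-measurable nonnegative random variable. A random time $\rho$ is an $(\mathcal{F}_t)$ pseudo-stopping time if $\mathbb{E}[M_\rho]=\mathbb{E}[M_0]$ for every $(\mathcal{F}_t)$-martingale $M$ with $\mathbb{E}[\sup_{t\ge0}|M_t|]<\infty$ (equivalently, for every bounded martingale). The dual optional projection $A^\rho$ of $1_{\{\rho\le t\}}$ is the càdlàg increasing adapted process (with $A^\rho_{0-}=0$) such that $\mathbb{E}[X_\rho]=\mathbb{E}[\int_{[0,\infty)}X_s\,dA^\rho_s]$ for every bounded $(\mathcal{F}_t)$-optional $X$. A randomized random variable on $(\Omega,\mathcal{F},\mathbb{P})$ is a probability measure $\mu$ on $([0,\infty]\times\Omega,\mathcal{B}([0,\infty])\otimes\mathcal{F})$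 whose projection on $\Omega$ equals $\mathbb{P}$. By a result of Föllmer, such a $\mu$ is represented by an increasing càdlàg process $A$ (with $A_{0-}=0$) through $\mu(X)=\mathbb{E}[\int X_s\,dA_s]$ for all nonnegative measurable processes $X$ (the projection being $\mathbb{P}$ means $A_\infty=1$ a.s.). If the process $A$ associated with $\mu$ is $(\mathcal{F}_t)$-adapted, $\mu$ is called a randomized stopping time. *)

theory Defs
  imports "HOL-Probability.Probability"
begin

text \<open>
  Processes on \<open>[0,\<infinity>)\<close> have type \<open>real \<Rightarrow> 'a \<Rightarrow> _\<close>; only the values at times \<open>t \<ge> 0\<close> and points of
  \<open>space M\<close> matter. The extended time axis \<open>[0,\<infinity>]\<close> is the type \<open>ennreal\<close>.
\<close>

locale usual_filtered_prob_space = prob_space M + complete_measure M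
  for M :: "'a measure" +
  fixes F :: "real \<Rightarrow> 'a measure"
  assumes subalgebra_F: "\<And>t. 0 \<le> t \<Longrightarrow> subalgebra M (F t)"
    and mono_F: "\<And>s t. 0 \<le> s \<Longrightarrow> s \<le> t \<Longrightarrow> sets (F s) \<subseteq> sets (F t)"
    and null_sets_F: "null_sets M \<subseteq> sets (F 0)"
    and right_continuous_F: "\<And>t. 0 \<le> t \<Longrightarrow> sets (F t) = (\<Inter>s\<in>{t<..}. sets (F s))"

definition cadlag :: "(real \<Rightarrow> real) \<Rightarrow> bool" where
  "cadlag f \<longleftrightarrow>
     (\<forall>t\<ge>0. continuous (at_right t) f) \<and> (\<forall>t>0. \<exists>l. (f \<longlongrightarrow> l) (at_left t))"

definition adapted :: "(real \<Rightarrow> 'a measure) \<Rightarrow> (real \<Rightarrow> 'a \<Rightarrow> real) \<Rightarrow> bool" where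
  "adapted F X \<longleftrightarrow> (\<forall>t\<ge>0. X t \<in> borel_measurable (F t))"

definition cadlag_process :: "'a measure \<Rightarrow> (real \<Rightarrow> 'a \<Rightarrow> real) \<Rightarrow> bool" where
  "cadlag_process M X \<longleftrightarrow> (\<forall>\<omega>\<in>space M. cadlag (\<lambda>t. X t \<omega>))"

definition cadlag_martingale ::
    "'a measure \<Rightarrow> (real \<Rightarrow> 'a measure) \<Rightarrow> (real \<Rightarrow> 'a \<Rightarrow> real) \<Rightarrow> bool" where
  "cadlag_martingale M F X \<longleftrightarrow>
     adapted F X \<and> cadlag_process M X \<and> (\<forall>t\<ge>0. integrable M (X t)) \<and>
     (\<forall>s t. 0 \<le> s \<longrightarrow> s \<le> t \<longrightarrow> (AE \<omega> in M. real_cond_exp M (F s) (X t) \<omega> = X s \<omega>))"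

text \<open>
  \<open>limit_sample X \<rho>\<close> is \<open>X\<^sub>\<rho>\<close> with \<open>X\<^sub>\<infinity> = lim X\<^sub>t\<close>; for the martingales considered below this limit
  exists almost surely.
\<close>

definition limit_sample :: "(real \<Rightarrow> 'a \<Rightarrow> real) \<Rightarrow> ('a \<Rightarrow> ennreal) \<Rightarrow> 'a \<Rightarrow> real" where
  "limit_sample X \<rho> \<omega> =
     (if \<rho> \<omega> = \<infinity> then Lim at_top (\<lambda>t. X t \<omega>) else X (enn2real (\<rho> \<omega>)) \<omega>)"

definition pseudo_stopping_time ::
    "'a measure \<Rightarrow> (real \<Rightarrow> 'a measure) \<Rightarrow> ('a \<Rightarrow> ennreal) \<Rightarrow> bool" where
  "pseudo_stopping_time M F \<rho> \<longleftrightarrow>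
     \<rho> \<in> borel_measurable M \<and>
     (\<forall>X. cadlag_martingale M F X \<longrightarrow>
          (\<integral>\<^sup>+\<omega>. (SUP t\<in>{0..}. ennreal \<bar>X t \<omega>\<bar>) \<partial>M) < \<infinity> \<longrightarrow>
          (\<integral>\<omega>. limit_sample X \<rho> \<omega> \<partial>M) = (\<integral>\<omega>. X 0 \<omega> \<partial>M))"

text \<open>
  The optional sigma-algebra lives on \<open>[0,\<infinity>) \<times> \<Omega>\<close>, so optionality says nothing about the
  values of a process at negative times.
\<close>

definition optional_algebra :: "'a measure \<Rightarrow> (real \<Rightarrow> 'a measure) \<Rightarrow> (real \<times> 'a) measure" where
  "optional_algebra M F =
     sigma ({0..} \<times> space M)
       {{(t, \<omega>) \<in> {0..} \<times> space M. X t \<omega> \<in> B} | X B.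
          adapted F X \<and> cadlag_process M X \<and> B \<in> sets borel}"

definition optional_process ::
    "'a measure \<Rightarrow> (real \<Rightarrow> 'a measure) \<Rightarrow> (real \<Rightarrow> 'a \<Rightarrow> 'b::topological_space) \<Rightarrow> bool" where
  "optional_process M F X \<longleftrightarrow> (\<lambda>(t, \<omega>). X t \<omega>) \<in> borel_measurable (optional_algebra M F)"

definition bounded_process :: "'a measure \<Rightarrow> (real \<Rightarrow> 'a \<Rightarrow> real) \<Rightarrow> bool" where
  "bounded_process M X \<longleftrightarrow> (\<exists>K. \<forall>t\<ge>0. \<forall>\<omega>\<in>space M. \<bar>X t \<omega>\<bar> \<le> K)"

text \<open>
  A process on \<open>[0,\<infinity>)\<close> is evaluated at an extended time as \<open>X\<^sub>t 1\<^bsub>{t < \<infinity>}\<^esub>\<close>.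
\<close>

definition sample :: "(real \<Rightarrow> 'a \<Rightarrow> 'b::zero) \<Rightarrow> ennreal \<Rightarrow> 'a \<Rightarrow> 'b" where
  "sample X t \<omega> = (if t = \<infinity> then 0 else X (enn2real t) \<omega>)"

text \<open>The convention \<open>A\<^bsub>0-\<^esub> = 0\<close> turns monotonicity at \<open>0\<close> into \<open>0 \<le> A 0 \<omega>\<close>.\<close>

definition increasing_process :: "'a measure \<Rightarrow> (real \<Rightarrow> 'a \<Rightarrow> real) \<Rightarrow> bool" where
  "increasing_process M A \<longleftrightarrow>
     cadlag_process M A \<and> (\<forall>\<omega>\<in>space M. 0 \<le> A 0 \<omega> \<and> mono_on {0..} (\<lambda>t. A t \<omega>))"

text \<open>
  The Stieltjes measure \<open>dA(\<omega>)\<close> on \<open>[0,\<infinity>)\<close>. Since \<open>A\<^bsub>0-\<^esub> = 0\<close>, it has an atom of mass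
  \<open>A 0 \<omega>\<close> at \<open>0\<close>.
\<close>

definition path_measure :: "(real \<Rightarrow> 'a \<Rightarrow> real) \<Rightarrow> 'a \<Rightarrow> real measure" where
  "path_measure A \<omega> =
     restrict_space (interval_measure (\<lambda>t. if t < 0 then 0 else A t \<omega>)) {0..}"

text \<open>
  The finiteness of \<open>E[A\<^sub>\<infinity>]\<close> is what the defining identity says for \<open>X = 1\<close> when its right-hand
  side is a genuine expectation; it is stated separately because the Bochner integral is \<open>0\<close>
  for functions that are not integrable.
\<close>

definition dual_optional_projection ::
    "'a measure \<Rightarrow> (real \<Rightarrow> 'a measure) \<Rightarrow> ('a \<Rightarrow> ennreal) \<Rightarrow> (real \<Rightarrow> 'a \<Rightarrow> real) \<Rightarrow> bool" where
  "dual_optional_projection M F \<rho> A \<longleftrightarrow>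
     increasing_process M A \<and> adapted F A \<and>
     (\<integral>\<^sup>+\<omega>. emeasure (path_measure A \<omega>) {0..} \<partial>M) < \<infinity> \<and>
     (\<forall>X :: real \<Rightarrow> 'a \<Rightarrow> real. optional_process M F X \<longrightarrow> bounded_process M X \<longrightarrow>
        (\<integral>\<omega>. sample X (\<rho> \<omega>) \<omega> \<partial>M) = (\<integral>\<omega>. (\<integral>s. X s \<omega> \<partial>path_measure A \<omega>) \<partial>M))"

text \<open>
  \<open>E[\<integral> X dA]\<close> over \<open>[0,\<infinity>]\<close>, where \<open>J \<omega>\<close> is the jump \<open>A\<^sub>\<infinity> - A\<^bsub>\<infinity>-\<^esub>\<close> at infinity. For \<open>J = 0\<close> it is
  the expectation of the integral over \<open>[0,\<infinity>)\<close>.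
\<close>

definition stieltjes_expectation ::
    "'a measure \<Rightarrow> (real \<Rightarrow> 'a \<Rightarrow> real) \<Rightarrow> ('a \<Rightarrow> ennreal) \<Rightarrow> (ennreal \<times> 'a \<Rightarrow> ennreal) \<Rightarrow> ennreal" where
  "stieltjes_expectation M A J X =
     (\<integral>\<^sup>+\<omega>. (\<integral>\<^sup>+s. X (ennreal s, \<omega>) \<partial>path_measure A \<omega>) + X (\<infinity>, \<omega>) * J \<omega> \<partial>M)"

definition follmer_measure ::
    "'a measure \<Rightarrow> (real \<Rightarrow> 'a \<Rightarrow> real) \<Rightarrow> (ennreal \<times> 'a) measure" where
  "follmer_measure M A =
     measure_of (UNIV \<times> space M) (sets (borel \<Otimes>\<^sub>M M))
       (\<lambda>B. stieltjes_expectation M A (\<lambda>_. 0) (indicator B))"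

definition randomized_random_variable :: "'a measure \<Rightarrow> (ennreal \<times> 'a) measure \<Rightarrow> bool" where
  "randomized_random_variable M \<mu> \<longleftrightarrow>
     prob_space \<mu> \<and> sets \<mu> = sets (borel \<Otimes>\<^sub>M M) \<and> distr \<mu> M snd = M"

definition follmer_representation ::
    "'a measure \<Rightarrow> (ennreal \<times> 'a) measure \<Rightarrow> (real \<Rightarrow> 'a \<Rightarrow> real) \<Rightarrow> ('a \<Rightarrow> ennreal) \<Rightarrow> bool" where
  "follmer_representation M \<mu> A J \<longleftrightarrow>
     increasing_process M A \<and> (\<forall>t\<ge>0. A t \<in> borel_measurable M) \<and> J \<in> borel_measurable M \<and>
     (\<forall>X \<in> borel_measurable (borel \<Otimes>\<^sub>M M). (\<integral>\<^sup>+z. X z \<partial>\<mu>) = stieltjes_expectation M A J X)"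

text \<open>
  The process representing \<open>\<mu>\<close> is unique up to indistinguishability, and under the usual
  conditions adaptedness does not depend on the choice of version.
\<close>

definition randomized_stopping_time ::
    "'a measure \<Rightarrow> (real \<Rightarrow> 'a measure) \<Rightarrow> (ennreal \<times> 'a) measure \<Rightarrow> bool" where
  "randomized_stopping_time M F \<mu> \<longleftrightarrow>
     randomized_random_variable M \<mu> \<and>
     (\<exists>A J. follmer_representation M \<mu> A J \<and> adapted F A)"

end

theory Submission
  imports Defs
begin

text \<open>
  The whole statement rests on one fact: the total mass \<open>A\<^sub>\<infinity>\<close> of \<open>dA\<close> equals \<open>1\<close> almost surely
  (\<open>total_mass_eq_1\<close>). Once this is known, \<open>\<omega> \<mapsto> dA(\<omega>)\<close> is (almost surely) a probability kernel and the Foellmer measure is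
  the law of the pair \<open>(s, \<omega>)\<close> obtained by first drawing \<open>\<omega>\<close> from \<open>M\<close> and then \<open>s\<close> from \<open>dA(\<omega>)\<close>
  (\<open>follmer_measure_eq_bind\<close>). The integral formulas are Fubini's theorem for this kernel, the projection on \<open>\<Omega>\<close> is \<open>M\<close> because the
  kernel has mass one, and for optional integrands the formula turns into the defining
  identity of the dual optional projection.

  That \<open>E[A\<^sub>\<infinity>] = 1\<close> is the defining identity for \<open>X = 1\<close>. The pseudo-stopping time property enters
  to show \<open>A\<^sub>\<infinity> \<le> 1\<close>: let \<open>X\<close> be the cadlag martingale closed by the indicator of
  \<open>B = {A\<^sub>\<infinity> > 1}\<close>. Then
    \<open>P(B) = E[X\<^sub>0] = E[X\<^sub>\<rho>] = E[\<integral> X dA] = E[1\<^sub>B A\<^sub>\<infinity>]\<close>,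
  which forces \<open>P(B) = 0\<close>. The last equality holds since \<open>A\<close> is adapted: if the integrand is frozen at
  the right end point of each interval of a grid, every increment of \<open>A\<close> is measurable at the time where
  the martingale is evaluated, so that \<open>X\<close> may be replaced by its terminal value; right-continuity of \<open>X\<close>
  lets the mesh go to zero (\<open>nn_integral_martingale_eq_terminal\<close>).

  The cadlag version of \<open>E[1\<^sub>B | F\<^sub>t]\<close> comes from \<open>cadlag_version_exists\<close>. Instead of upcrossings its proof
  counts oscillations of size \<open>\<epsilon>\<close> greedily: the squares of the successive moves have expected
  sum at most \<open>1\<close> by orthogonality of martingale increments, so the expected number of moves on any
  grid is at most \<open>1 / \<epsilon>\<^sup>2\<close> (\<open>expected_osc_count\<close>). With Fatou's lemma along the dyadic grids, almost every path has only
  finitely many oscillations of each size, hence one-sided limits along the dyadic numbers, and the right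
  limits form the desired version.
\<close>

section \<open>Oscillations of a function along the dyadic numbers\<close>

text \<open>
  A greedy reference level: it stays put until the sequence has moved away from it by at least \<open>e\<close>,
  and then jumps to the current value. \<open>osc_count\<close> counts these jumps.
\<close>

primrec osc_ref :: "real \<Rightarrow> (nat \<Rightarrow> real) \<Rightarrow> nat \<Rightarrow> real" where
  "osc_ref e x 0 = x 0"
| "osc_ref e x (Suc k) = (if e \<le> \<bar>x (Suc k) - osc_ref e x k\<bar> then x (Suc k) else osc_ref e x k)"

primrec osc_count :: "real \<Rightarrow> (nat \<Rightarrow> real) \<Rightarrow> nat \<Rightarrow> nat" where
  "osc_count e x 0 = 0"
| "osc_count e x (Suc k) = osc_count e x k + (if e \<le> \<bar>x (Suc k) - osc_ref e x k\<bar> then 1 else 0)"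

lemma osc_count_mono: "i \<le> j \<Longrightarrow> osc_count e x i \<le> osc_count e x j"
  by (induction j rule: dec_induct) auto

lemma osc_ref_close: "0 < e \<Longrightarrow> \<bar>x k - osc_ref e x k\<bar> < e"
  by (induction k) auto

lemma osc_ref_eq_if_count_eq:
  "i \<le> j \<Longrightarrow> osc_count e x i = osc_count e x j \<Longrightarrow> osc_ref e x i = osc_ref e x j"
proof (induction j rule: dec_induct)
  case (step n)
  have "osc_count e x i \<le> osc_count e x n" using step by (intro osc_count_mono) auto
  with step show ?case by (auto split: if_splits)
qed simp

text \<open>
  The sequence is always within \<open>e\<close> of the reference level, so an oscillation of size \<open>2 e\<close> cannot
  happen while the level stays put. Thus the greedy count dominates the number of
  oscillations over disjoint intervals, however these are chosen.
\<close>

lemma osc_count_oscillation: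
  assumes "0 < e" "i \<le> j" "2 * e \<le> \<bar>x j - x i\<bar>"
  shows "osc_count e x i + 1 \<le> osc_count e x j"
proof (rule ccontr)
  assume "\<not> ?thesis"
  with osc_count_mono[OF assms(2), of e x] have "osc_count e x i = osc_count e x j" by simp
  from osc_ref_eq_if_count_eq[OF assms(2) this]
    osc_ref_close[OF assms(1), of x i] osc_ref_close[OF assms(1), of x j] assms(3)
  show False by linarith
qed

text \<open>
  The quantity \<open>(x\<^sub>k - r\<^sub>k)\<^sup>2 + \<Sum> (jumps of r)\<^sup>2\<close> does not change at all when the level is updated, since
  a jump moves the square from the first term to the second. Hence it grows only through the steps
  of \<open>x\<close>, namely by \<open>x\<^sub>k\<^sub>+\<^sub>1\<^sup>2 - x\<^sub>k\<^sup>2 - 2 r\<^sub>k (x\<^sub>k\<^sub>+\<^sub>1 - x\<^sub>k)\<close>. For a martingale the last term, in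
  which \<open>r\<^sub>k\<close> depends only on the past, has expectation zero.
\<close>

lemma osc_count_le_quadratic:
  assumes "0 < e"
  shows "e\<^sup>2 * osc_count e x k \<le> (x k)\<^sup>2 - 2 * (\<Sum>i<k. osc_ref e x i * (x (Suc i) - x i))"
proof -
  have "(x k - osc_ref e x k)\<^sup>2 + e\<^sup>2 * osc_count e x k
      \<le> (x k)\<^sup>2 - (x 0)\<^sup>2 - 2 * (\<Sum>i<k. osc_ref e x i * (x (Suc i) - x i))"
  proof (induction k)
    case (Suc k)
    let ?r = "osc_ref e x k" and ?d = "x (Suc k) - osc_ref e x k"
    have "(x (Suc k) - osc_ref e x (Suc k))\<^sup>2 + e\<^sup>2 * osc_count e x (Suc k)
        \<le> ?d\<^sup>2 + e\<^sup>2 * osc_count e x k"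
    proof (cases "e \<le> \<bar>?d\<bar>")
      case True
      then have "e\<^sup>2 \<le> ?d\<^sup>2" using assms by (metis abs_le_square_iff abs_of_pos)
      with True show ?thesis by (simp add: algebra_simps)
    qed simp
    also have "?d\<^sup>2 + e\<^sup>2 * osc_count e x k
        = ((x k - ?r)\<^sup>2 + e\<^sup>2 * osc_count e x k) + ((x (Suc k))\<^sup>2 - (x k)\<^sup>2) - 2 * (?r * (x (Suc k) - x k))"
      by (simp add: power2_eq_square algebra_simps)
    finally show ?case using Suc by (simp add: algebra_simps)
  qed simp
  moreover have "0 \<le> (x k - osc_ref e x k)\<^sup>2" "0 \<le> (x 0)\<^sup>2" by simp_all
  ultimately show ?thesis by linarith
qed

lemma osc_ref_bounded: "(\<And>k. 0 \<le> x k \<and> x k \<le> 1) \<Longrightarrow> 0 \<le> osc_ref e x k \<and> osc_ref e x k \<le> (1::real)"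
  by (induction k) auto

definition dyadics :: "real set" where
  "dyadics = {real k / 2 ^ m | k m. True}"

definition next_dyadic :: "nat \<Rightarrow> real \<Rightarrow> real" where
  "next_dyadic k t = (of_int \<lfloor>t * 2 ^ k\<rfloor> + 1) / 2 ^ k"

lemma next_dyadic_gt: "t < next_dyadic k t"
  and next_dyadic_le: "next_dyadic k t \<le> t + 1 / 2 ^ k"
proof -
  have "t * 2^k < of_int \<lfloor>t * 2 ^ k\<rfloor> + 1" by linarith
  then show "t < next_dyadic k t" by (simp add: next_dyadic_def pos_less_divide_eq)
  have "of_int \<lfloor>t * 2 ^ k\<rfloor> + 1 \<le> t * 2 ^ k + 1" by linarith
  then show "next_dyadic k t \<le> t + 1 / 2 ^ k" by (simp add: next_dyadic_def field_simps)
qed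

lemma next_dyadic_mem: "0 \<le> t \<Longrightarrow> next_dyadic k t \<in> dyadics"
proof -
  assume "0 \<le> t"
  then have "0 \<le> \<lfloor>t * 2 ^ k\<rfloor>" by simp
  then have "real (nat (\<lfloor>t * 2 ^ k\<rfloor> + 1)) = of_int \<lfloor>t * 2 ^ k\<rfloor> + 1"
    by (metis add_increasing2 of_int_1 of_int_add of_nat_nat zero_le_one)
  then show ?thesis unfolding dyadics_def next_dyadic_def by (metis (mono_tags, lifting) mem_Collect_eq)
qed

lemma next_dyadic_tendsto: "(\<lambda>k. next_dyadic k t) \<longlonglongrightarrow> t"
proof (rule tendsto_sandwich[of "\<lambda>_. t" _ _ "\<lambda>k. t + 1 / 2 ^ k"])
  show "(\<lambda>k. t + 1 / 2 ^ k) \<longlonglongrightarrow> t"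
    using tendsto_add[OF tendsto_const[of t] LIMSEQ_divide_realpow_zero[of 2 1]] by simp
qed (auto intro!: always_eventually less_imp_le next_dyadic_gt next_dyadic_le)

lemma dyadic_eventually_grid:
  assumes "p \<in> dyadics"
  shows "\<forall>\<^sub>F m in sequentially. real (nat \<lfloor>p * 2 ^ m\<rfloor>) / 2 ^ m = p"
proof -
  from assms obtain k n where p: "p = real k / 2 ^ n" by (auto simp: dyadics_def)
  show ?thesis
  proof (rule eventually_sequentiallyI[of n])
    fix m assume "n \<le> m"
    then have "(2::real) ^ m = 2 ^ (m - n) * 2 ^ n" by (simp flip: power_add)
    then have "p * 2 ^ m = real (k * 2 ^ (m - n))" by (simp add: p)
    then have "nat \<lfloor>p * 2 ^ m\<rfloor> = k * 2 ^ (m - n)" by (metis floor_of_nat nat_int)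
    then show "real (nat \<lfloor>p * 2 ^ m\<rfloor>) / 2 ^ m = p"
      using \<open>(2::real) ^ m = 2 ^ (m - n) * 2 ^ n\<close> by (simp add: p)
  qed
qed

text \<open>
  Infinitely many grids with a common bound suffice below, because a given finite family of dyadic
  intervals is resolved by all sufficiently fine grids. This weak form is what Fatou's lemma provides.
\<close>

definition finitely_oscillating :: "(real \<Rightarrow> real) \<Rightarrow> bool" where
  "finitely_oscillating f \<longleftrightarrow>
     (\<forall>n. \<exists>J. \<exists>\<^sub>F m in sequentially.
        osc_count (1 / real (Suc n)) (\<lambda>k. f (real k / 2 ^ m)) (m * 2 ^ m) \<le> J)"

text \<open>
  \<open>R j a b\<close> reads: on all sufficiently fine grids the greedy count increases by at least \<open>j\<close> between \<open>a\<close>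
  and \<open>b\<close>. The following properties of \<open>R\<close> are all that the one-sided limits need: counts over
  consecutive intervals add up, an oscillation counts at least once, and the counts are bounded.
\<close>

lemma oscillations_bounded:
  fixes f :: "real \<Rightarrow> real"
  assumes fin: "finitely_oscillating f" and "0 < e"
  obtains R :: "nat \<Rightarrow> real \<Rightarrow> real \<Rightarrow> bool" and J where
    "\<And>a b c d i j. R i a b \<Longrightarrow> R j c d \<Longrightarrow> b \<le> c \<Longrightarrow> R (i + j) a d"
    "\<And>p q. p \<in> dyadics \<Longrightarrow> q \<in> dyadics \<Longrightarrow> p \<le> q \<Longrightarrow> e \<le> \<bar>f q - f p\<bar> \<Longrightarrow> R 1 p q"
    "\<And>a. R 0 a a"
    "\<And>a b j. R j a b \<Longrightarrow> j \<le> J"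
proof -
  obtain n where n: "2 / e < real n" using reals_Archimedean2 by blast
  define h where "h = 1 / real (Suc n)"
  have h: "0 < h" "2 * h \<le> e"
    using n \<open>0 < e\<close> by (auto simp: h_def field_simps)
  define cnt where "cnt m a = osc_count h (\<lambda>k. f (real k / 2 ^ m)) (nat \<lfloor>a * 2 ^ m\<rfloor>)" for m and a :: real
  define R where "R j a b \<longleftrightarrow> (\<forall>\<^sub>F m in sequentially. cnt m a + j \<le> cnt m b)" for j :: nat and a b :: real
  have cnt_mono: "cnt m a \<le> cnt m b" if "a \<le> b" for m a b
    unfolding cnt_def using that by (intro osc_count_mono nat_mono floor_mono mult_right_mono) auto
  obtain J where J: "\<exists>\<^sub>F m in sequentially. osc_count h (\<lambda>k. f (real k / 2 ^ m)) (m * 2 ^ m) \<le> J"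
    using fin unfolding finitely_oscillating_def h_def by blast
  show thesis
  proof
    fix a b c d i j assume ab: "R i a b" and cd: "R j c d" and "b \<le> c"
    from ab cd show "R (i + j) a d" unfolding R_def
    proof eventually_elim
      case (elim m)
      then show ?case using cnt_mono[OF \<open>b \<le> c\<close>, of m] by linarith
    qed
  next
    fix p q assume pq: "p \<in> dyadics" "q \<in> dyadics" "p \<le> q" "e \<le> \<bar>f q - f p\<bar>"
    show "R 1 p q" unfolding R_def
      using dyadic_eventually_grid[OF pq(1)] dyadic_eventually_grid[OF pq(2)]
    proof eventually_elim
      case (elim m)
      show ?case unfolding cnt_def
        by (rule osc_count_oscillation)
           (use h pq elim in \<open>auto intro!: nat_mono floor_mono mult_right_mono\<close>)
    qed
  next
    fix a b j assume "R j a b"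
    moreover obtain N :: nat where "b < N" using reals_Archimedean2 by blast
    moreover have "\<forall>\<^sub>F m in sequentially. N \<le> m" by (rule eventually_ge_at_top)
    ultimately have "\<forall>\<^sub>F m in sequentially. cnt m a + j \<le> cnt m b \<and> N \<le> m"
      unfolding R_def by (simp add: eventually_conj_iff)
    from frequently_eventually_conj[OF J this]
    obtain m where m: "osc_count h (\<lambda>k. f (real k / 2 ^ m)) (m * 2 ^ m) \<le> J"
        "cnt m a + j \<le> cnt m b" "N \<le> m"
      using frequently_ex by blast
    have "b \<le> real m" using m \<open>b < N\<close> by linarith
    then have "b * 2 ^ m \<le> real (m * 2 ^ m)" by simp
    then have "nat \<lfloor>b * 2 ^ m\<rfloor> \<le> m * 2 ^ m" by linarith
    from osc_count_mono[OF this] m show "j \<le> J" unfolding cnt_def by (meson add_leE le_trans)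
  qed (simp add: R_def)
qed

lemma convergent_if_oscillation_free:
  fixes f :: "real \<Rightarrow> real"
  assumes "\<And>e. 0 < e \<Longrightarrow> \<exists>P. eventually P F \<and> (\<forall>p q. P p \<and> P q \<and> p \<le> q \<longrightarrow> \<bar>f q - f p\<bar> < e)"
  shows "\<exists>l. (f \<longlongrightarrow> l) F"
proof (cases "F = bot")
  case False
  have "cauchy_filter (filtermap f F)"
    unfolding cauchy_filter_metric_filtermap
  proof (intro allI impI)
    fix e :: real assume "0 < e"
    from assms[OF this] obtain P where P: "eventually P F"
        "\<forall>p q. P p \<and> P q \<and> p \<le> q \<longrightarrow> \<bar>f q - f p\<bar> < e" by blast
    have "dist (f x) (f y) < e" if "P x" "P y" for x y
      using P(2)[rule_format, of x y] P(2)[rule_format, of y x] that linear[of x y]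
      by (auto simp: dist_real_def abs_minus_commute)
    with P(1) show "\<exists>P. eventually P F \<and> (\<forall>x y. P x \<and> P y \<longrightarrow> dist (f x) (f y) < e)" by blast
  qed
  then have "\<exists>l\<in>UNIV. filtermap f F \<le> nhds l"
    using complete_UNIV[where 'a=real] False unfolding complete_uniform
    by (auto simp: filtermap_bot_iff)
  then show ?thesis by (auto simp: filterlim_def)
qed simp

text \<open>
  If \<open>f\<close> were not Cauchy at \<open>t\<close> from the right, there would be oscillations of a fixed size in every
  interval to the right of \<open>t\<close>. Putting each new one between \<open>t\<close> and the previous ones
  gives arbitrarily many disjoint oscillations. The left limit is treated symmetrically.
\<close>

lemma right_limit_along_dyadics:
  assumes "finitely_oscillating f"
  shows "\<exists>l. (f \<longlongrightarrow> l) (at t within dyadics \<inter> {t<..})"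
proof (rule convergent_if_oscillation_free, rule ccontr)
  fix e :: real assume "0 < e"
  assume none: "\<not> (\<exists>P. eventually P (at t within dyadics \<inter> {t<..}) \<and>
                (\<forall>p q. P p \<and> P q \<and> p \<le> q \<longrightarrow> \<bar>f q - f p\<bar> < e))"
  have pairs: "\<exists>p q. p \<in> dyadics \<and> q \<in> dyadics \<and> t < p \<and> p \<le> q \<and> q < b \<and> e \<le> \<bar>f q - f p\<bar>"
    if "t < b" for b
  proof -
    have "eventually (\<lambda>x. x \<in> dyadics \<and> t < x \<and> x < b) (at t within dyadics \<inter> {t<..})"
      unfolding eventually_at using that by (intro exI[of _ "b - t"]) (auto simp: dist_real_def)
    with none have "\<not> (\<forall>p q. (p \<in> dyadics \<and> t < p \<and> p < b) \<and> (q \<in> dyadics \<and> t < q \<and> q < b) \<and> p \<le> q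
        \<longrightarrow> \<bar>f q - f p\<bar> < e)" by blast
    then show ?thesis by (auto simp: not_less) 
  qed
  obtain R :: "nat \<Rightarrow> real \<Rightarrow> real \<Rightarrow> bool" and J where
    R: "\<And>a b c d i j. R i a b \<Longrightarrow> R j c d \<Longrightarrow> b \<le> c \<Longrightarrow> R (i + j) a d"
    "\<And>p q. p \<in> dyadics \<Longrightarrow> q \<in> dyadics \<Longrightarrow> p \<le> q \<Longrightarrow> e \<le> \<bar>f q - f p\<bar> \<Longrightarrow> R 1 p q"
    "\<And>a. R 0 a a"
    "\<And>a b j. R j a b \<Longrightarrow> j \<le> J"
    using oscillations_bounded[OF assms \<open>0 < e\<close>] by blast
  have "\<exists>a c. t < a \<and> c < b \<and> R j a c" if "t < b" for j b
    using that
  proof (induction j arbitrary: b)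
    case 0
    then show ?case using R(3)[of "(t + b) / 2"] by (intro exI[of _ "(t + b) / 2"]) auto
  next
    case (Suc j)
    obtain p q where pq: "p \<in> dyadics" "q \<in> dyadics" "t < p" "p \<le> q" "q < b" "e \<le> \<bar>f q - f p\<bar>"
      using pairs[OF Suc.prems] by blast
    obtain a c where "t < a" "c < p" "R j a c" using Suc.IH[OF pq(3)] by blast
    with pq R(1)[of j a c 1 p q] R(2)[of p q] show ?case by auto
  qed
  from this[of "t + 1" "Suc J"] R(4) show False by (meson Suc_n_not_le_n less_add_one)
qed

lemma left_limit_along_dyadics:
  assumes "finitely_oscillating f"
  shows "\<exists>l. (f \<longlongrightarrow> l) (at t within dyadics \<inter> {..<t})"
proof (rule convergent_if_oscillation_free, rule ccontr)
  fix e :: real assume "0 < e"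
  assume none: "\<not> (\<exists>P. eventually P (at t within dyadics \<inter> {..<t}) \<and>
                (\<forall>p q. P p \<and> P q \<and> p \<le> q \<longrightarrow> \<bar>f q - f p\<bar> < e))"
  have pairs: "\<exists>p q. p \<in> dyadics \<and> q \<in> dyadics \<and> b < p \<and> p \<le> q \<and> q < t \<and> e \<le> \<bar>f q - f p\<bar>"
    if "b < t" for b
  proof -
    have "eventually (\<lambda>x. x \<in> dyadics \<and> b < x \<and> x < t) (at t within dyadics \<inter> {..<t})"
      unfolding eventually_at using that by (intro exI[of _ "t - b"]) (auto simp: dist_real_def)
    with none have "\<not> (\<forall>p q. (p \<in> dyadics \<and> b < p \<and> p < t) \<and> (q \<in> dyadics \<and> b < q \<and> q < t) \<and> p \<le> q
        \<longrightarrow> \<bar>f q - f p\<bar> < e)" by blast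
    then show ?thesis by (auto simp: not_less)
  qed
  obtain R :: "nat \<Rightarrow> real \<Rightarrow> real \<Rightarrow> bool" and J where
    R: "\<And>a b c d i j. R i a b \<Longrightarrow> R j c d \<Longrightarrow> b \<le> c \<Longrightarrow> R (i + j) a d"
    "\<And>p q. p \<in> dyadics \<Longrightarrow> q \<in> dyadics \<Longrightarrow> p \<le> q \<Longrightarrow> e \<le> \<bar>f q - f p\<bar> \<Longrightarrow> R 1 p q"
    "\<And>a. R 0 a a"
    "\<And>a b j. R j a b \<Longrightarrow> j \<le> J"
    using oscillations_bounded[OF assms \<open>0 < e\<close>] by blast
  have "\<exists>a c. b < a \<and> c < t \<and> R j a c" if "b < t" for j b
    using that
  proof (induction j arbitrary: b)
    case 0
    then show ?case using R(3)[of "(t + b) / 2"] by (intro exI[of _ "(t + b) / 2"]) auto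
  next
    case (Suc j)
    obtain p q where pq: "p \<in> dyadics" "q \<in> dyadics" "b < p" "p \<le> q" "q < t" "e \<le> \<bar>f q - f p\<bar>"
      using pairs[OF Suc.prems] by blast
    obtain a c where "q < a" "c < t" "R j a c" using Suc.IH[OF pq(5)] by blast
    with pq R(1)[of 1 p q j a c] R(2)[of p q] show ?case by auto
  qed
  from this[of "t - 1" "Suc J"] R(4) show False by (meson Suc_n_not_le_n diff_less_eq less_add_one)
qed

text \<open>
  The limit is taken along one fixed sequence decreasing to \<open>t\<close>, which makes the result measurable in
  \<open>\<omega>\<close> when \<open>f\<close> is a path of a process; for finitely oscillating \<open>f\<close> it is the full right limit
  along the dyadic numbers.
\<close>

definition dyadic_right_limit :: "(real \<Rightarrow> real) \<Rightarrow> real \<Rightarrow> real" where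
  "dyadic_right_limit f t = lim (\<lambda>k. f (next_dyadic k t))"

lemma dyadic_right_limit:
  assumes "finitely_oscillating f" "0 \<le> t"
  shows "(f \<longlongrightarrow> dyadic_right_limit f t) (at t within dyadics \<inter> {t<..})"
    and "(\<lambda>k. f (next_dyadic k t)) \<longlonglongrightarrow> dyadic_right_limit f t"
proof -
  obtain l where l: "(f \<longlongrightarrow> l) (at t within dyadics \<inter> {t<..})"
    using right_limit_along_dyadics[OF assms(1)] by blast
  have "filterlim (\<lambda>k. next_dyadic k t) (at t within dyadics \<inter> {t<..}) sequentially"
    unfolding filterlim_at using next_dyadic_tendsto next_dyadic_mem[OF assms(2)] next_dyadic_gt[of t]
    by (auto intro!: always_eventually simp: less_imp_neq[symmetric])
  from filterlim_compose[OF l this]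
  have *: "(\<lambda>k. f (next_dyadic k t)) \<longlonglongrightarrow> l" .
  then have "dyadic_right_limit f t = l" by (simp add: dyadic_right_limit_def limI)
  with l * show "(f \<longlongrightarrow> dyadic_right_limit f t) (at t within dyadics \<inter> {t<..})"
    "(\<lambda>k. f (next_dyadic k t)) \<longlonglongrightarrow> dyadic_right_limit f t" by auto
qed

lemma cadlag_dyadic_right_limit:
  assumes "finitely_oscillating f"
  shows "cadlag (dyadic_right_limit f)"
proof -
  let ?g = "dyadic_right_limit f"
  have close: "\<bar>?g u - l\<bar> \<le> e"
    if "\<And>q. q \<in> dyadics \<Longrightarrow> a < q \<Longrightarrow> q < b \<Longrightarrow> \<bar>f q - l\<bar> < e" "0 \<le> u" "a < u" "u < b" for a b l u e
  proof (rule tendsto_upperbound)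
    show "(\<lambda>k. \<bar>f (next_dyadic k u) - l\<bar>) \<longlonglongrightarrow> \<bar>?g u - l\<bar>"
      by (intro tendsto_intros dyadic_right_limit(2) assms that)
    have "\<forall>\<^sub>F k in sequentially. next_dyadic k u < b"
      using order_tendstoD(2)[OF next_dyadic_tendsto \<open>u < b\<close>] .
    then show "\<forall>\<^sub>F k in sequentially. \<bar>f (next_dyadic k u) - l\<bar> \<le> e"
    proof eventually_elim
      case (elim k)
      with that(1)[OF next_dyadic_mem[OF \<open>0 \<le> u\<close>], of k] next_dyadic_gt[of u k] \<open>a < u\<close>
      show ?case by linarith
    qed
  qed simp
  show ?thesis unfolding cadlag_def
  proof (intro conjI allI impI)
    fix t :: real assume "0 \<le> t"
    show "continuous (at_right t) ?g" unfolding continuous_within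
    proof (rule tendstoI)
      fix e :: real assume "0 < e"
      then have "\<forall>\<^sub>F q in at t within dyadics \<inter> {t<..}. dist (f q) (?g t) < e / 2"
        using tendstoD[OF dyadic_right_limit(1)[OF assms \<open>0 \<le> t\<close>], of "e / 2"] by simp
      then obtain d where d: "0 < d"
          "\<And>q. q \<in> dyadics \<Longrightarrow> t < q \<Longrightarrow> q < t + d \<Longrightarrow> \<bar>f q - ?g t\<bar> < e / 2"
        unfolding eventually_at by (auto simp: dist_real_def)
      have "\<bar>?g u - ?g t\<bar> \<le> e / 2" if "t < u" "u < t + d" for u
        by (rule close[of t "t + d"]) (use d that \<open>0 \<le> t\<close> in auto)
      with d(1) \<open>0 < e\<close> show "\<forall>\<^sub>F u in at_right t. dist (?g u) (?g t) < e"
        unfolding eventually_at_right_field dist_real_def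
        by (intro exI[of _ "t + d"]) force
    qed
  next
    fix t :: real assume "0 < t"
    obtain l where l: "(f \<longlongrightarrow> l) (at t within dyadics \<inter> {..<t})"
      using left_limit_along_dyadics[OF assms] by blast
    have "(?g \<longlongrightarrow> l) (at_left t)"
    proof (rule tendstoI)
      fix e :: real assume "0 < e"
      then have "\<forall>\<^sub>F q in at t within dyadics \<inter> {..<t}. dist (f q) l < e / 2"
        using tendstoD[OF l, of "e / 2"] by simp
      then obtain d where d: "0 < d"
          "\<And>q. q \<in> dyadics \<Longrightarrow> t - d < q \<Longrightarrow> q < t \<Longrightarrow> \<bar>f q - l\<bar> < e / 2"
        unfolding eventually_at by (auto simp: dist_real_def)
      have "\<bar>?g u - l\<bar> \<le> e / 2" if "max 0 (t - d) < u" "u < t" for u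
        by (rule close[of "t - d" t]) (use d that in auto)
      with d(1) \<open>0 < e\<close> \<open>0 < t\<close> show "\<forall>\<^sub>F u in at_left t. dist (?g u) l < e"
        unfolding eventually_at_left_field dist_real_def
        by (intro exI[of _ "max 0 (t - d)"]) force
    qed
    then show "\<exists>l. (?g \<longlongrightarrow> l) (at_left t)" ..
  qed
qed

section \<open>Cadlag versions of bounded martingales\<close>

text \<open>
  Some version of the martingale \<open>E[Z | F\<^sub>t]\<close> of a random variable with values in the unit interval. The
  bounds hold at every point, not only almost surely, so that bounded and dominated convergence apply
  path by path.
\<close>

definition unit_closed_martingale ::
    "'a measure \<Rightarrow> (real \<Rightarrow> 'a measure) \<Rightarrow> ('a \<Rightarrow> real) \<Rightarrow> (real \<Rightarrow> 'a \<Rightarrow> real) \<Rightarrow> bool" where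
  "unit_closed_martingale M F Z N \<longleftrightarrow>
     (\<forall>t\<ge>0. N t \<in> borel_measurable (F t) \<and> (\<forall>\<omega>\<in>space M. N t \<omega> \<in> {0..1}) \<and>
            (AE \<omega> in M. real_cond_exp M (F t) Z \<omega> = N t \<omega>))"

context usual_filtered_prob_space
begin

lemma sigma_finite_subalgebra_F: "0 \<le> t \<Longrightarrow> sigma_finite_subalgebra M (F t)"
  using finite_measure_subalgebra.axioms finite_measure_subalgebra.intro
    finite_measure_subalgebra_axioms.intro subalgebra_F finite_measure_axioms
  by (metis finite_measure_subalgebra_is_sigma_finite)

lemma space_F: "0 \<le> t \<Longrightarrow> space (F t) = space M"
  using subalgebra_F by (auto simp: subalgebra_def)

lemma measurable_F_mono:
  "f \<in> measurable (F s) K \<Longrightarrow> 0 \<le> s \<Longrightarrow> s \<le> t \<Longrightarrow> f \<in> measurable (F t) K"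
  by (rule measurable_from_subalg[of "F t" "F s"])
     (auto simp: subalgebra_def space_F mono_F)

lemma measurable_F_imp_M:
  "f \<in> measurable (F s) K \<Longrightarrow> 0 \<le> s \<Longrightarrow> f \<in> measurable M K"
  by (rule measurable_from_subalg[OF subalgebra_F])

lemma null_sets_in_F: "B \<in> null_sets M \<Longrightarrow> 0 \<le> t \<Longrightarrow> B \<in> sets (F t)"
  using null_sets_F mono_F[of 0 t] by auto

lemma unit_closed_martingale_integral:
  assumes "unit_closed_martingale M F Z N" "0 \<le> t"
    and [measurable]: "Z \<in> borel_measurable M"
    and H: "H \<in> borel_measurable (F t)" "integrable M (\<lambda>\<omega>. H \<omega> * Z \<omega>)"
  shows "integrable M (\<lambda>\<omega>. H \<omega> * N t \<omega>)" "(\<integral>\<omega>. H \<omega> * N t \<omega> \<partial>M) = (\<integral>\<omega>. H \<omega> * Z \<omega> \<partial>M)"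
proof -
  interpret sigma_finite_subalgebra M "F t" by (rule sigma_finite_subalgebra_F) fact
  have N: "N t \<in> borel_measurable (F t)" "AE \<omega> in M. real_cond_exp M (F t) Z \<omega> = N t \<omega>"
    using assms(1,2) by (auto simp: unit_closed_martingale_def)
  note [measurable] = measurable_F_imp_M[OF N(1) assms(2)] measurable_F_imp_M[OF H(1) assms(2)]
  have eq: "AE \<omega> in M. H \<omega> * N t \<omega> = H \<omega> * real_cond_exp M (F t) Z \<omega>"
    using N(2) by eventually_elim simp
  from real_cond_exp_intg[OF H(2,1) assms(3)]
  show "integrable M (\<lambda>\<omega>. H \<omega> * N t \<omega>)" "(\<integral>\<omega>. H \<omega> * N t \<omega> \<partial>M) = (\<integral>\<omega>. H \<omega> * Z \<omega> \<partial>M)"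
    using integrable_cong_AE[OF _ _ eq] integral_cong_AE[OF _ _ eq] by simp_all
qed

text \<open>
  In the quadratic bound for the count the martingale increments are multiplied by the reference level,
  which depends only on the past; their expectation vanishes and \<open>E[N\<^sup>2] \<le> 1\<close> remains.
\<close>

lemma expected_osc_count:
  assumes N: "unit_closed_martingale M F Z N"
    and Z: "Z \<in> borel_measurable M" "\<And>\<omega>. \<omega> \<in> space M \<Longrightarrow> Z \<omega> \<in> {0..1}"
    and q: "mono q" "0 \<le> q 0" and "0 < e"
  shows "(\<integral>\<^sup>+\<omega>. ennreal (e\<^sup>2 * osc_count e (\<lambda>k. N (q k) \<omega>) n) \<partial>M) \<le> 1"
    and "(\<lambda>\<omega>. osc_count e (\<lambda>k. N (q k) \<omega>) n) \<in> measurable M (count_space UNIV)"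
proof -
  have q0: "0 \<le> q k" for k using q by (meson le0 monoD order_trans)
  have NF: "N (q k) \<in> borel_measurable (F (q k))" and N01: "\<omega> \<in> space M \<Longrightarrow> N (q k) \<omega> \<in> {0..1}" for k \<omega>
    using N q0 by (auto simp: unit_closed_martingale_def)
  note NM[measurable] = measurable_F_imp_M[OF NF q0]
  let ?R = "\<lambda>k \<omega>. osc_ref e (\<lambda>k. N (q k) \<omega>) k"
  have R01: "?R k \<omega> \<in> {0..1}" if "\<omega> \<in> space M" for k \<omega>
    using osc_ref_bounded[of "\<lambda>k. N (q k) \<omega>" e k] N01[OF that] by auto
  have RF: "?R k \<in> borel_measurable (F (q k))" for k
  proof (induction k)
    case (Suc k)
    have [measurable]: "?R k \<in> borel_measurable (F (q (Suc k)))"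
      by (rule measurable_F_mono[OF Suc q0]) (use q in \<open>auto intro: monoD\<close>)
    note [measurable] = NF[of "Suc k"]
    show ?case unfolding osc_ref.simps by measurable
  qed (use NF in simp)
  note RM[measurable] = measurable_F_imp_M[OF RF q0]
  show cnt[measurable]: "(\<lambda>\<omega>. osc_count e (\<lambda>k. N (q k) \<omega>) n) \<in> measurable M (count_space UNIV)"
  proof (induction n)
    case (Suc n)
    note [measurable] = Suc
    show ?case unfolding osc_count.simps by measurable
  qed simp
  have bdd: "integrable M f" if "f \<in> borel_measurable M" "\<And>\<omega>. \<omega> \<in> space M \<Longrightarrow> f \<omega> \<in> {0..1}" for f :: "'a \<Rightarrow> real"
    using that by (intro integrable_const_bound[of _ 1]) auto
  have mult01: "a * b \<in> {0..1}" if "a \<in> {0..1}" "b \<in> {0..1}" for a b :: real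
    using that by (auto simp: mult_le_one)
  have NI: "integrable M (\<lambda>\<omega>. ?R i \<omega> * N (q j) \<omega>)" and ZI: "integrable M (\<lambda>\<omega>. ?R i \<omega> * Z \<omega>)" for i j
    using N01 R01 Z by (intro bdd mult01; measurable)+
  have incr: "(\<integral>\<omega>. ?R i \<omega> * (N (q (Suc i)) \<omega> - N (q i) \<omega>) \<partial>M) = 0" for i
  proof -
    have "?R i \<in> borel_measurable (F (q (Suc i)))"
      by (rule measurable_F_mono[OF RF q0]) (use q in \<open>auto intro: monoD\<close>)
    from unit_closed_martingale_integral(2)[OF N q0 Z(1) this ZI] unit_closed_martingale_integral(2)[OF N q0 Z(1) RF ZI]
    show ?thesis by (simp add: right_diff_distrib NI)
  qed
  let ?g = "\<lambda>\<omega>. (N (q n) \<omega>)\<^sup>2 - 2 * (\<Sum>i<n. ?R i \<omega> * (N (q (Suc i)) \<omega> - N (q i) \<omega>))"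
  have sqI: "integrable M (\<lambda>\<omega>. (N (q n) \<omega>)\<^sup>2)"
    using N01 by (intro bdd) (auto simp: power_le_one)
  have sumI: "integrable M (\<lambda>\<omega>. (\<Sum>i<n. ?R i \<omega> * (N (q (Suc i)) \<omega> - N (q i) \<omega>)))"
    by (intro Bochner_Integration.integrable_sum) (simp add: right_diff_distrib NI)
  have le: "e\<^sup>2 * osc_count e (\<lambda>k. N (q k) \<omega>) n \<le> ?g \<omega>" for \<omega>
    by (rule osc_count_le_quadratic) fact
  have "(\<integral>\<^sup>+\<omega>. ennreal (e\<^sup>2 * osc_count e (\<lambda>k. N (q k) \<omega>) n) \<partial>M) \<le> (\<integral>\<^sup>+\<omega>. ennreal (?g \<omega>) \<partial>M)"
    by (intro nn_integral_mono ennreal_leI le)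
  also have "\<dots> = ennreal (\<integral>\<omega>. ?g \<omega> \<partial>M)"
    by (intro nn_integral_eq_integral Bochner_Integration.integrable_diff sqI integrable_mult_right sumI
          AE_I2 order_trans[OF _ le]) auto
  also have "(\<integral>\<omega>. ?g \<omega> \<partial>M) = (\<integral>\<omega>. (N (q n) \<omega>)\<^sup>2 \<partial>M)"
    using sqI sumI by (subst Bochner_Integration.integral_diff)
       (auto simp: right_diff_distrib NI incr[unfolded right_diff_distrib])
  also have "ennreal \<dots> \<le> ennreal (\<integral>\<omega>. 1 \<partial>M)"
    using N01 by (intro ennreal_leI integral_mono sqI) (auto simp: power_le_one)
  finally show "(\<integral>\<^sup>+\<omega>. ennreal (e\<^sup>2 * osc_count e (\<lambda>k. N (q k) \<omega>) n) \<partial>M) \<le> 1"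
    by (simp add: prob_space)
qed

lemma AE_finitely_oscillating:
  assumes N: "unit_closed_martingale M F Z N"
    and Z: "Z \<in> borel_measurable M" "\<And>\<omega>. \<omega> \<in> space M \<Longrightarrow> Z \<omega> \<in> {0..1}"
  shows "AE \<omega> in M. finitely_oscillating (\<lambda>t. N t \<omega>)"
  unfolding finitely_oscillating_def AE_all_countable
proof
  fix n
  define e where "e = 1 / real (Suc n)"
  have "0 < e" by (simp add: e_def)
  define c where "c m \<omega> = osc_count e (\<lambda>k. N (real k / 2 ^ m) \<omega>) (m * 2 ^ m)" for m \<omega>
  have "mono (\<lambda>k. real k / 2 ^ m)" for m by (auto simp: mono_def divide_right_mono)
  note E = expected_osc_count[OF N Z this _ \<open>0 < e\<close>, simplified, folded c_def]
  have E: "(\<integral>\<^sup>+\<omega>. ennreal (e\<^sup>2 * c m \<omega>) \<partial>M) \<le> 1" "c m \<in> measurable M (count_space UNIV)" for m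
    unfolding c_def by (rule E; simp)+
  note [measurable] = E(2)
  have "(\<integral>\<^sup>+\<omega>. liminf (\<lambda>m. ennreal (e\<^sup>2 * c m \<omega>)) \<partial>M) \<le> liminf (\<lambda>m. \<integral>\<^sup>+\<omega>. ennreal (e\<^sup>2 * c m \<omega>) \<partial>M)"
    by (intro nn_integral_liminf) measurable
  also have "\<dots> \<le> liminf (\<lambda>m. 1)"
    by (intro Liminf_mono always_eventually allI E)
  also have "\<dots> = (1::ennreal)" by (simp add: Liminf_const)
  finally have "(\<integral>\<^sup>+\<omega>. liminf (\<lambda>m. ennreal (e\<^sup>2 * c m \<omega>)) \<partial>M) \<noteq> \<infinity>"
    by (auto simp: top_unique)
  then have "AE \<omega> in M. liminf (\<lambda>m. ennreal (e\<^sup>2 * c m \<omega>)) \<noteq> \<infinity>"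
    by (intro nn_integral_noteq_infinite) measurable
  then show "AE \<omega> in M. \<exists>J. \<exists>\<^sub>F m in sequentially.
      osc_count (1 / real (Suc n)) (\<lambda>k. N (real k / 2 ^ m) \<omega>) (m * 2 ^ m) \<le> J"
  proof eventually_elim
    case (elim \<omega>)
    then obtain K :: nat where K: "liminf (\<lambda>m. ennreal (e\<^sup>2 * c m \<omega>)) < of_nat K"
      using ennreal_Ex_less_of_nat by (auto simp: less_top)
    obtain J :: nat where J: "real K / e\<^sup>2 < J" using reals_Archimedean2 by blast
    have "\<exists>\<^sub>F m in sequentially. c m \<omega> \<le> J"
    proof (rule ccontr)
      assume "\<not> ?thesis"
      then have "\<forall>\<^sub>F m in sequentially. of_nat K \<le> ennreal (e\<^sup>2 * c m \<omega>)"
        unfolding not_frequently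
      proof eventually_elim
        case (elim m)
        have "real K \<le> e\<^sup>2 * J" using J \<open>0 < e\<close> by (simp add: field_simps)
        also have "\<dots> \<le> e\<^sup>2 * c m \<omega>" using elim by (intro mult_left_mono) auto
        finally show ?case by (simp add: ennreal_of_nat_eq_real_of_nat ennreal_leI)
      qed
      from Liminf_bounded[OF this] K show False by simp
    qed
    then show ?case unfolding c_def e_def by blast
  qed
qed

text \<open>
  The version is the right limit along the dyadic numbers of an arbitrary version, set to zero on the
  exceptional null set. The usual conditions enter twice: null sets belong to \<open>F\<^sub>0\<close>, and
  a right limit at \<open>t\<close>, which is measurable at every time after \<open>t\<close>, is \<open>F\<^sub>t\<close>-measurable by
  right-continuity of the filtration.
\<close>

lemma cadlag_version_exists:
  assumes Z: "Z \<in> borel_measurable M" "\<And>\<omega>. \<omega> \<in> space M \<Longrightarrow> Z \<omega> \<in> {0..1}"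
  obtains X where "unit_closed_martingale M F Z X" "cadlag_process M X"
proof -
  have ZI: "integrable M Z" using Z by (intro integrable_const_bound[of _ 1]) auto
  \<comment> \<open>Clipping makes the bounds, which conditional expectations satisfy almost surely, hold everywhere.\<close>
  define N where "N t \<omega> = max 0 (min 1 (real_cond_exp M (F t) Z \<omega>))" for t \<omega>
  have N: "unit_closed_martingale M F Z N" unfolding unit_closed_martingale_def
  proof (intro allI impI conjI ballI)
    fix t :: real assume "0 \<le> t"
    then interpret sigma_finite_subalgebra M "F t" by (rule sigma_finite_subalgebra_F)
    show "N t \<in> borel_measurable (F t)" unfolding N_def by measurable
    have "AE \<omega> in M. 0 \<le> real_cond_exp M (F t) Z \<omega>" "AE \<omega> in M. real_cond_exp M (F t) Z \<omega> \<le> 1"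
      using Z by (intro real_cond_exp_ge_c real_cond_exp_le_c ZI AE_I2; auto)+
    then show "AE \<omega> in M. real_cond_exp M (F t) Z \<omega> = N t \<omega>"
      by eventually_elim (auto simp: N_def)
  qed (auto simp: N_def)
  then have NF: "0 \<le> t \<Longrightarrow> N t \<in> borel_measurable (F t)" for t
    by (auto simp: unit_closed_martingale_def)
  define G where "G = {\<omega>\<in>space M. finitely_oscillating (\<lambda>t. N t \<omega>)}"
  have "space M - G \<in> null_sets M"
    using AE_finitely_oscillating[OF N Z] unfolding AE_iff_null_sets G_def
    by (simp add: set_diff_eq cong: conj_cong)
  then have AEG: "AE \<omega> in M. \<omega> \<in> G" using AE_not_in AE_space by fastforce
  have GF: "G \<in> sets (F t)" if "0 \<le> t" for t
  proof -
    have "space (F t) - (space M - G) \<in> sets (F t)"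
      using null_sets_in_F[OF \<open>space M - G \<in> null_sets M\<close> that] by auto
    then show ?thesis using space_F[OF that] by (simp add: G_def Diff_Diff_Int Int_def cong: conj_cong)
  qed
  define X where "X t \<omega> = (if \<omega> \<in> G then dyadic_right_limit (\<lambda>t. N t \<omega>) t else 0)" for t \<omega>
  have lim: "(\<lambda>k. if \<omega> \<in> G then N (next_dyadic k t) \<omega> else 0) \<longlonglongrightarrow> X t \<omega>" if "0 \<le> t" for t \<omega>
    using dyadic_right_limit(2)[of "\<lambda>t. N t \<omega>" t] that by (auto simp: X_def G_def)
  have XF: "X t \<in> borel_measurable (F t)" if t: "0 \<le> t" for t
  proof (rule measurableI)
    have Xs: "X t \<in> borel_measurable (F s)" if "t < s" for s
    proof -
      \<comment> \<open>Dropping the first terms of the approximating sequence, all times used lie before \<open>s\<close>.\<close>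
      have "\<forall>\<^sub>F k in sequentially. next_dyadic k t < s"
        by (rule order_tendstoD(2)[OF next_dyadic_tendsto that])
      then obtain k0 where k0: "\<And>k. k0 \<le> k \<Longrightarrow> next_dyadic k t < s"
        by (auto simp: eventually_sequentially)
      have [measurable]: "N (next_dyadic (k + k0) t) \<in> borel_measurable (F s)" for k
        using k0[of "k + k0"] next_dyadic_gt[of t "k + k0"] t
        by (intro measurable_F_mono[OF NF]) auto
      have [measurable]: "G \<in> sets (F s)" using GF t that by auto
      show ?thesis
        by (rule borel_measurable_LIMSEQ_real[OF LIMSEQ_ignore_initial_segment[OF lim[OF t], where k=k0]]) measurable
    qed
    fix B :: "real set" assume "B \<in> sets borel"
    then have "X t -` B \<inter> space M \<in> sets (F s)" if "t < s" for s
      using measurable_sets[OF Xs[OF that]] space_F[of s] that t by auto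
    then show "X t -` B \<inter> space (F t) \<in> sets (F t)"
      unfolding right_continuous_F[OF t] space_F[OF t] by auto
  qed simp
  have X01: "X t \<omega> \<in> {0..1}" if "0 \<le> t" for t \<omega>
    using lim[OF that, of \<omega>] by (rule closed_sequentially[OF closed_atLeastAtMost, rotated])
      (auto simp: N_def)
  have "unit_closed_martingale M F Z X" unfolding unit_closed_martingale_def
  proof (intro allI impI conjI ballI)
    fix t :: real assume t: "0 \<le> t"
    interpret sigma_finite_subalgebra M "F t" by (rule sigma_finite_subalgebra_F) fact
    note XM[measurable] = measurable_F_imp_M[OF XF[OF t] t]
    show "X t \<in> borel_measurable (F t)" "X t \<omega> \<in> {0..1}" for \<omega> using XF X01 t by auto
    show "AE \<omega> in M. real_cond_exp M (F t) Z \<omega> = X t \<omega>"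
    proof (rule real_cond_exp_charact)
      show "integrable M (X t)" using X01[OF t] by (intro integrable_const_bound[of _ 1]) auto
      fix B assume B: "B \<in> sets (F t)"
      have BM[measurable]: "B \<in> sets M" using B subalgebra_F[OF t] by (auto simp: subalgebra_def)
      have dy: "0 \<le> next_dyadic k t" "t \<le> next_dyadic k t" for k using next_dyadic_gt[of t k] t by auto
      have [measurable]: "N (next_dyadic k t) \<in> borel_measurable M" for k
        by (rule measurable_F_imp_M[OF NF]; rule dy)
      have eq: "(\<integral>\<omega>. indicator B \<omega> * N (next_dyadic k t) \<omega> \<partial>M) = (\<integral>\<omega>. indicator B \<omega> * Z \<omega> \<partial>M)" for k
      proof (rule unit_closed_martingale_integral(2)[OF N dy(1) Z(1)])
        show "indicator B \<in> borel_measurable (F (next_dyadic k t))"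
          using B mono_F[OF t dy(2)] by (intro borel_measurable_indicator) auto
        show "integrable M (\<lambda>\<omega>. indicator B \<omega> * Z \<omega>)"
          using Z by (intro integrable_const_bound[of _ 1]) (auto simp: indicator_def)
      qed
      have "(\<lambda>k. \<integral>\<omega>. indicator B \<omega> * N (next_dyadic k t) \<omega> \<partial>M) \<longlonglongrightarrow> (\<integral>\<omega>. indicator B \<omega> * X t \<omega> \<partial>M)"
      proof (rule integral_dominated_convergence[where w="\<lambda>_. 1"])
        show "AE \<omega> in M. (\<lambda>k. indicator B \<omega> * N (next_dyadic k t) \<omega>) \<longlonglongrightarrow> indicator B \<omega> * X t \<omega>"
          using AEG
        proof eventually_elim
          case (elim \<omega>)
          with lim[OF t, of \<omega>] show ?case by (intro tendsto_intros) simp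
        qed
      qed (auto simp: N_def indicator_def)
      then show "(\<integral>\<omega>\<in>B. Z \<omega> \<partial>M) = (\<integral>\<omega>\<in>B. X t \<omega> \<partial>M)"
        unfolding eq set_lebesgue_integral_def using LIMSEQ_unique[OF tendsto_const] by auto
    qed (use ZI XF[OF t] in auto)
  qed
  moreover have "cadlag_process M X"
    unfolding cadlag_process_def
  proof
    fix \<omega> assume "\<omega> \<in> space M"
    show "cadlag (\<lambda>t. X t \<omega>)"
    proof (cases "\<omega> \<in> G")
      case True
      then have "cadlag (dyadic_right_limit (\<lambda>t. N t \<omega>))"
        by (intro cadlag_dyadic_right_limit) (simp add: G_def)
      with True show ?thesis by (simp add: X_def)
    qed (auto simp: X_def cadlag_def intro!: exI[of _ 0])
  qed
  ultimately show thesis by (rule that)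
qed

lemma unit_closed_martingale_imp_cadlag_martingale:
  assumes Z: "Z \<in> borel_measurable M" "\<And>\<omega>. \<omega> \<in> space M \<Longrightarrow> Z \<omega> \<in> {0..1}"
    and X: "unit_closed_martingale M F Z X" "cadlag_process M X"
  shows "cadlag_martingale M F X"
  unfolding cadlag_martingale_def
proof (intro conjI allI impI)
  have XF: "0 \<le> t \<Longrightarrow> X t \<in> borel_measurable (F t)" for t
    using X by (auto simp: unit_closed_martingale_def)
  then show "adapted F X" by (auto simp: adapted_def)
  show XI: "integrable M (X t)" if "0 \<le> t" for t
    using measurable_F_imp_M[OF XF[OF that] that] X that
    by (intro integrable_const_bound[of _ 1]) (auto simp: unit_closed_martingale_def)
  fix s t :: real assume st: "0 \<le> s" "s \<le> t"
  interpret sigma_finite_subalgebra M "F s" by (rule sigma_finite_subalgebra_F) fact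
  show "AE \<omega> in M. real_cond_exp M (F s) (X t) \<omega> = X s \<omega>"
  proof (rule real_cond_exp_charact)
    fix B assume B: "B \<in> sets (F s)"
    then have "B \<in> sets M" "B \<in> sets (F t)" using subalgebra_F[OF st(1)] mono_F[OF st] by (auto simp: subalgebra_def)
    then have "(\<integral>\<omega>. indicator B \<omega> * X u \<omega> \<partial>M) = (\<integral>\<omega>. indicator B \<omega> * Z \<omega> \<partial>M)" if "u = s \<or> u = t" for u
      using st that B Z
      by (intro unit_closed_martingale_integral(2)[OF X(1) _ Z(1)] integrable_const_bound[of _ 1])
         (auto simp: indicator_def intro!: borel_measurable_indicator)
    then show "(\<integral>\<omega>\<in>B. X t \<omega> \<partial>M) = (\<integral>\<omega>\<in>B. X s \<omega> \<partial>M)"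
      by (simp add: set_lebesgue_integral_def)
  qed (use XI XF st in auto)
qed (fact X)

end

section \<open>Optional processes are jointly measurable\<close>

text \<open>
  The smallest point of the grid of mesh \<open>1 / (m + 1)\<close> that is not below \<open>s\<close>, for \<open>s \<ge> 0\<close>; negative
  times are sent to \<open>0\<close>. Rounding up is essential: cadlag paths are continuous from the right,
  and an increment of an adapted process is measurable at the right end point of its interval.
\<close>

definition right_grid :: "nat \<Rightarrow> real \<Rightarrow> real" where
  "right_grid m s = real (nat \<lceil>s * real (Suc m)\<rceil>) / real (Suc m)"

lemma right_grid_ge: "s \<le> right_grid m s"
  and right_grid_le: "0 \<le> s \<Longrightarrow> right_grid m s \<le> s + 1 / real (Suc m)"
proof -
  have "s * real (Suc m) \<le> real (nat \<lceil>s * real (Suc m)\<rceil>)" by linarith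
  then show "s \<le> right_grid m s" unfolding right_grid_def by (simp add: pos_le_divide_eq del: of_nat_Suc)
  assume "0 \<le> s"
  then have "0 \<le> s * real (Suc m)" by simp
  then have "real (nat \<lceil>s * real (Suc m)\<rceil>) \<le> s * real (Suc m) + 1" by linarith
  then have "right_grid m s \<le> (s * real (Suc m) + 1) / real (Suc m)"
    unfolding right_grid_def by (rule divide_right_mono) simp
  then show "right_grid m s \<le> s + 1 / real (Suc m)"
    by (simp add: add_divide_distrib del: of_nat_Suc)
qed

lemma right_grid_tendsto: "0 \<le> s \<Longrightarrow> (\<lambda>m. right_grid m s) \<longlonglongrightarrow> s"
proof (rule tendsto_sandwich[of "\<lambda>_. s" _ _ "\<lambda>m. s + 1 / real (Suc m)"])
  show "(\<lambda>m. s + 1 / real (Suc m)) \<longlonglongrightarrow> s"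
    using tendsto_add[OF tendsto_const[of s] LIMSEQ_inverse_real_of_nat] by (simp add: inverse_eq_divide)
qed (auto intro!: always_eventually right_grid_ge right_grid_le simp del: of_nat_Suc)

lemma cadlag_right_grid_tendsto:
  assumes "cadlag f" "0 \<le> s"
  shows "(\<lambda>m. f (right_grid m s)) \<longlonglongrightarrow> f s"
proof (rule continuous_within_tendsto_compose'[of s "{s..}" f])
  show "continuous (at s within {s..}) f"
    using assms by (simp add: cadlag_def at_within_Ici_at_right)
qed (auto intro: right_grid_ge right_grid_tendsto assms)

lemma cadlag_measurable_nonneg:
  assumes "cadlag f"
  shows "(\<lambda>s. f (max 0 s)) \<in> borel_measurable borel"
proof (rule borel_measurable_LIMSEQ_real)
  show "(\<lambda>m. f (right_grid m (max 0 s))) \<longlonglongrightarrow> f (max 0 s)" for s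
    by (rule cadlag_right_grid_tendsto[OF assms]) simp
  show "(\<lambda>s. f (right_grid m (max 0 s))) \<in> borel_measurable borel" for m
    unfolding right_grid_def
    by (rule measurable_compose[where N="count_space UNIV" and g="\<lambda>k. f (real k / real (Suc m))"]) measurable
qed

context usual_filtered_prob_space
begin

lemma cadlag_adapted_jointly_measurable:
  assumes "adapted F X" "cadlag_process M X"
  shows "(\<lambda>(t, \<omega>). X (max 0 t) \<omega>) \<in> borel_measurable (borel \<Otimes>\<^sub>M M)"
proof (rule borel_measurable_LIMSEQ_real)
  fix z :: "real \<times> 'a" assume "z \<in> space (borel \<Otimes>\<^sub>M M)"
  then have "cadlag (\<lambda>t. X t (snd z))"
    using assms by (auto simp: cadlag_process_def space_pair_measure)
  from cadlag_right_grid_tendsto[OF this, of "max 0 (fst z)"]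
  show "(\<lambda>m. X (right_grid m (max 0 (fst z))) (snd z)) \<longlonglongrightarrow> (case z of (t, \<omega>) \<Rightarrow> X (max 0 t) \<omega>)"
    by (simp add: case_prod_beta)
next
  fix m
  have [measurable]: "X (real k / real (Suc m)) \<in> borel_measurable M" for k
    by (rule measurable_F_imp_M[of _ "real k / real (Suc m)"])
       (use assms in \<open>auto simp: adapted_def simp del: of_nat_Suc\<close>)
  show "(\<lambda>z. X (right_grid m (max 0 (fst z))) (snd z)) \<in> borel_measurable (borel \<Otimes>\<^sub>M M)"
    unfolding right_grid_def
    by (rule measurable_compose_countable[where f="\<lambda>k z. X (real k / real (Suc m)) (snd z)"]) measurable
qed

text \<open>
  Only times \<open>t \<ge> 0\<close> matter for an optional process, so the product sigma-algebra has to be restricted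
  to \<open>[0,\<infinity>) \<times> \<Omega>\<close> before it can be compared with the optional one.
\<close>

lemma optional_jointly_measurable:
  assumes "f \<in> measurable (optional_algebra M F) K"
  shows "f \<in> measurable (restrict_space (borel \<Otimes>\<^sub>M M) ({0..} \<times> space M)) K"
proof -
  let ?R = "restrict_space (borel \<Otimes>\<^sub>M M) ({0::real..} \<times> space M)"
  have sp: "space ?R = {0..} \<times> space M" by (auto simp: space_restrict_space space_pair_measure)
  let ?G = "{{(t, \<omega>) \<in> {0..} \<times> space M. X t \<omega> \<in> B} | X B.
          adapted F X \<and> cadlag_process M X \<and> B \<in> sets borel}"
  have "sigma_sets ({0..} \<times> space M) ?G \<subseteq> sets ?R"
  proof (subst sp[symmetric], rule sets.sigma_sets_subset, safe)
    fix X B assume X: "adapted F X" "cadlag_process M X" and B: "B \<in> sets (borel :: real measure)"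
    note [measurable] = cadlag_adapted_jointly_measurable[OF X] B
    have "{z \<in> space (borel \<Otimes>\<^sub>M M). (case z of (t, \<omega>) \<Rightarrow> X (max 0 t) \<omega>) \<in> B} \<in> sets (borel \<Otimes>\<^sub>M M)"
      by measurable
    then have "({0..} \<times> space M) \<inter> {z \<in> space (borel \<Otimes>\<^sub>M M). (case z of (t, \<omega>) \<Rightarrow> X (max 0 t) \<omega>) \<in> B} \<in> sets ?R"
      by (auto simp: sets_restrict_space)
    also have "({0..} \<times> space M) \<inter> {z \<in> space (borel \<Otimes>\<^sub>M M). (case z of (t, \<omega>) \<Rightarrow> X (max 0 t) \<omega>) \<in> B}
       = {(t, \<omega>) \<in> {0..} \<times> space M. X t \<omega> \<in> B}"
      by (auto simp: space_pair_measure max_def)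
    finally show "{(t, \<omega>) \<in> {0..} \<times> space M. X t \<omega> \<in> B} \<in> sets ?R" .
  qed
  moreover have G: "?G \<subseteq> Pow ({0..} \<times> space M)" by auto
  ultimately have "subalgebra ?R (optional_algebra M F)"
    unfolding subalgebra_def optional_algebra_def sp by (simp add: space_measure_of sets_measure_of)
  from measurable_from_subalg[OF this assms] show ?thesis .
qed

lemma sample_measurable:
  fixes X :: "real \<Rightarrow> 'a \<Rightarrow> 'b::{topological_space, zero}"
  assumes "optional_process M F X"
  shows "(\<lambda>(t, \<omega>). sample X t \<omega>) \<in> borel_measurable (borel \<Otimes>\<^sub>M M)"
proof -
  have "(\<lambda>z. (enn2real (fst z), snd z))
      \<in> measurable (borel \<Otimes>\<^sub>M M) (restrict_space (borel \<Otimes>\<^sub>M M) ({0..} \<times> space M))"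
    by (rule measurable_restrict_space2) (auto simp: space_pair_measure)
  from measurable_compose[OF this optional_jointly_measurable[OF assms[unfolded optional_process_def]]]
  have [measurable]: "(\<lambda>z. X (enn2real (fst z)) (snd z)) \<in> borel_measurable (borel \<Otimes>\<^sub>M M)"
    by simp
  show ?thesis unfolding sample_def case_prod_beta by measurable
qed

lemma sample_at_random_time_measurable:
  fixes X :: "real \<Rightarrow> 'a \<Rightarrow> 'b::{topological_space, zero}"
  assumes "optional_process M F X" "\<rho> \<in> borel_measurable M"
  shows "(\<lambda>\<omega>. sample X (\<rho> \<omega>) \<omega>) \<in> borel_measurable M"
  using measurable_compose[OF measurable_Pair[OF assms(2) measurable_ident_sets[OF refl]] sample_measurable[OF assms(1)]]
  by simp

lemma cadlag_adapted_optional: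
  assumes "adapted F X" "cadlag_process M X"
  shows "optional_process M F X"
  unfolding optional_process_def
proof (rule measurableI)
  have G: "{{(t, \<omega>) \<in> {0..} \<times> space M. X t \<omega> \<in> B} | X B.
          adapted F X \<and> cadlag_process M X \<and> B \<in> sets borel} \<subseteq> Pow ({0..} \<times> space M)" by auto
  fix B :: "real set" assume "B \<in> sets borel"
  then have "{(t, \<omega>) \<in> {0..} \<times> space M. X t \<omega> \<in> B} \<in> sets (optional_algebra M F)"
    unfolding optional_algebra_def sets_measure_of[OF G] using assms by (intro sigma_sets.Basic) blast
  also have "{(t, \<omega>) \<in> {0..} \<times> space M. X t \<omega> \<in> B}
     = (\<lambda>(t, \<omega>). X t \<omega>) -` B \<inter> space (optional_algebra M F)"
    unfolding optional_algebra_def space_measure_of[OF G] by auto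
  finally show "(\<lambda>(t, \<omega>). X t \<omega>) -` B \<inter> space (optional_algebra M F) \<in> sets (optional_algebra M F)" .
qed simp

end

section \<open>Stieltjes measures of increasing paths\<close>

lemma sets_path_measure: "sets (path_measure A \<omega>) = sets (restrict_space borel {0..})"
  unfolding path_measure_def by (rule sets_restrict_space_cong) simp

lemma space_path_measure [simp]: "space (path_measure A \<omega>) = {0..}"
  unfolding path_measure_def by (simp add: space_restrict_space)

lemma measurable_path_measure: "f \<in> measurable borel K \<Longrightarrow> f \<in> measurable (path_measure A \<omega>) K"
  unfolding measurable_cong_sets[OF sets_path_measure refl] by (rule measurable_restrict_space1)

lemma cadlag_measurable_path:
  assumes "cadlag f"
  shows "f \<in> borel_measurable (path_measure A \<omega>)"
proof -
  have "(\<lambda>s. f (max 0 s)) \<in> borel_measurable (path_measure A \<omega>)"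
    by (rule measurable_path_measure[OF cadlag_measurable_nonneg[OF assms]])
  then show ?thesis by (subst measurable_cong[where g="\<lambda>s. f (max 0 s)"]) (auto simp: max_def)
qed

text \<open>
  The distribution function is extended by \<open>0\<close> to negative times, so \<open>(-1, 0)\<close> carries no mass and the
  interval \<open>[0, b]\<close> has the same mass as \<open>(-1, b]\<close>. This is where the atom at \<open>0\<close> is accounted for.
\<close>

lemma
  assumes A: "increasing_process M A" and \<omega>: "\<omega> \<in> space M"
  shows emeasure_path_measure_Icc: "0 \<le> b \<Longrightarrow> emeasure (path_measure A \<omega>) {0..b} = ennreal (A b \<omega>)"
    and emeasure_path_measure_Ioc:
      "0 \<le> a \<Longrightarrow> a \<le> b \<Longrightarrow> emeasure (path_measure A \<omega>) {a<..b} = ennreal (A b \<omega> - A a \<omega>)"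
proof -
  define g where "g t = (if t < 0 then 0 else A t \<omega>)" for t
  have A0: "0 \<le> A 0 \<omega>" and Amono: "0 \<le> s \<Longrightarrow> s \<le> t \<Longrightarrow> A s \<omega> \<le> A t \<omega>" and cad: "cadlag (\<lambda>t. A t \<omega>)" for s t
    using A \<omega> by (auto simp: increasing_process_def cadlag_process_def mono_on_def)
  have mono: "g x \<le> g y" if "x \<le> y" for x y
    using that Amono[of 0 y] Amono[of x y] A0 by (auto simp: g_def)
  have rc: "continuous (at_right a) g" for a
  proof (cases "0 \<le> a")
    case True
    have "((\<lambda>t. A t \<omega>) \<longlongrightarrow> A a \<omega>) (at_right a)"
      using cad True by (simp add: cadlag_def continuous_within)
    moreover have "\<forall>\<^sub>F t in at_right a. A t \<omega> = g t"
      using True by (auto simp: eventually_at_right_field g_def intro!: exI[of _ "a + 1"])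
    ultimately show ?thesis
      using True by (auto simp: continuous_within g_def intro: Lim_transform_eventually)
  next
    case False
    have "\<forall>\<^sub>F t in at_right a. 0 = g t"
      using False by (auto simp: eventually_at_right_field g_def intro!: exI[of _ 0])
    then have "(g \<longlongrightarrow> 0) (at_right a)" by (rule Lim_transform_eventually[OF tendsto_const])
    with False show ?thesis by (simp add: continuous_within g_def)
  qed
  note Ioc = emeasure_interval_measure_Ioc[OF _ mono rc]
  have path: "path_measure A \<omega> = restrict_space (interval_measure g) {0..}"
    by (simp add: path_measure_def g_def[abs_def])
  have eq: "emeasure (path_measure A \<omega>) S = emeasure (interval_measure g) S" if "S \<subseteq> {0..}" for S
    unfolding path using that by (intro emeasure_restrict_space) auto
  show "emeasure (path_measure A \<omega>) {a<..b} = ennreal (A b \<omega> - A a \<omega>)" if "0 \<le> a" "a \<le> b"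
    using that by (subst eq) (auto simp: Ioc g_def)
  assume "0 \<le> b"
  have cover_null: "(\<Union>n. {-1<..-1 / real (Suc n)}) \<in> null_sets (interval_measure g)"
    by (intro null_sets_UN null_setsI) (auto simp: Ioc g_def divide_simps)
  have cover: "{-1<..<0::real} \<subseteq> (\<Union>n. {-1<..-1 / real (Suc n)})"
  proof
    fix x :: real assume x: "x \<in> {-1<..<0}"
    then obtain n where "1 / real (Suc n) < - x" using nat_approx_posE[of "- x"] by auto
    with x show "x \<in> (\<Union>n. {-1<..-1 / real (Suc n)})" by (auto intro!: exI[of _ n] simp del: of_nat_Suc)
  qed
  have "{-1<..<0} \<in> null_sets (interval_measure g)"
    by (rule null_sets_subset[OF cover_null _ cover]) simp
  then have "emeasure (interval_measure g) ({0..b} \<union> {-1<..<0}) = emeasure (interval_measure g) {0..b}"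
    by (intro emeasure_Un_null_set) auto
  also have "{0..b} \<union> {-1<..<0} = {-1<..b}" using \<open>0 \<le> b\<close> by auto
  also have "emeasure (interval_measure g) {-1<..b} = ennreal (g b - g (-1))"
    using \<open>0 \<le> b\<close> by (intro Ioc) simp
  also have "g b - g (-1) = A b \<omega>" using \<open>0 \<le> b\<close> by (simp add: g_def)
  finally show "emeasure (path_measure A \<omega>) {0..b} = ennreal (A b \<omega>)"
    by (subst eq) simp_all
qed

abbreviation total_mass :: "(real \<Rightarrow> 'a \<Rightarrow> real) \<Rightarrow> 'a \<Rightarrow> ennreal" where
  "total_mass A \<omega> \<equiv> emeasure (path_measure A \<omega>) {0..}"

lemma total_mass_measurable:
  assumes A: "increasing_process M A" and "\<And>t. 0 \<le> t \<Longrightarrow> A t \<in> borel_measurable M"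
  shows "total_mass A \<in> borel_measurable M"
proof -
  have [measurable]: "A (real n) \<in> borel_measurable M" for n using assms by simp
  have "total_mass A \<omega> = (SUP n. ennreal (A (real n) \<omega>))" if "\<omega> \<in> space M" for \<omega>
  proof -
    have U: "(\<Union>n. {0..real n}) = {0..}" by (auto intro: real_arch_simple)
    have "(SUP n. emeasure (path_measure A \<omega>) {0..real n}) = emeasure (path_measure A \<omega>) (\<Union>n. {0..real n})"
      by (intro SUP_emeasure_incseq) (auto simp: sets_path_measure sets_restrict_space incseq_def intro!: image_eqI[of _ _ "{0..real _}"])
    with U show ?thesis by (simp add: emeasure_path_measure_Icc[OF A that])
  qed
  then show ?thesis by (subst measurable_cong) auto
qed

text \<open>
  For \<open>k = 0\<close> this is the mass \<open>A\<^sub>0\<close> of the atom at zero, in accordance with \<open>A\<^bsub>0-\<^esub> = 0\<close>.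
\<close>

definition grid_increment :: "(real \<Rightarrow> 'a \<Rightarrow> real) \<Rightarrow> nat \<Rightarrow> nat \<Rightarrow> 'a \<Rightarrow> real" where
  "grid_increment A m k \<omega> =
     A (real k / real (Suc m)) \<omega> - (if k = 0 then 0 else A (real (k - 1) / real (Suc m)) \<omega>)"

lemma nn_integral_path_measure_grid:
  fixes x :: "nat \<Rightarrow> ennreal"
  assumes A: "increasing_process M A" and \<omega>: "\<omega> \<in> space M"
  shows "(\<integral>\<^sup>+s. x (nat \<lceil>s * real (Suc m)\<rceil>) \<partial>path_measure A \<omega>)
       = (\<Sum>k. x k * ennreal (grid_increment A m k \<omega>))"
proof -
  let ?h = "real (Suc m)"
  define I where "I k = {s. 0 \<le> s \<and> nat \<lceil>s * ?h\<rceil> = k}" for k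
  have h: "0 < ?h" by simp
  have I0: "I 0 = {0..0}"
  proof -
    have "s * ?h \<le> 0 \<longleftrightarrow> s \<le> 0" for s using h by (simp add: mult_le_0_iff del: of_nat_Suc)
    then show ?thesis by (auto simp: I_def simp del: of_nat_Suc)
  qed
  have IS: "I (Suc j) = {real j / ?h<..real (Suc j) / ?h}" for j
  proof -
    have "0 \<le> s \<and> nat \<lceil>s * ?h\<rceil> = Suc j \<longleftrightarrow> real j < s * ?h \<and> s * ?h \<le> real (Suc j)" for s
    proof -
      have "nat \<lceil>s * ?h\<rceil> = Suc j \<longleftrightarrow> \<lceil>s * ?h\<rceil> = int j + 1" by linarith
      also have "\<dots> \<longleftrightarrow> real j < s * ?h \<and> s * ?h \<le> real (Suc j)"
        by (simp add: ceiling_eq_iff add.commute del: of_nat_Suc) (simp add: add.commute)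
      finally have *: "nat \<lceil>s * ?h\<rceil> = Suc j \<longleftrightarrow> real j < s * ?h \<and> s * ?h \<le> real (Suc j)" .
      have "0 \<le> s" if "real j < s * ?h"
      proof -
        have "0 < s * ?h" using that of_nat_0_le_iff[of j] by linarith
        then show ?thesis using h by (simp add: zero_less_mult_iff del: of_nat_Suc)
      qed
      with * show ?thesis by blast
    qed
    then have "I (Suc j) = {s. real j < s * ?h \<and> s * ?h \<le> real (Suc j)}"
      unfolding I_def by (simp only:)
    also have "\<dots> = {real j / ?h<..real (Suc j) / ?h}"
      by (simp only: pos_divide_less_eq[OF h, symmetric] pos_le_divide_eq[OF h, symmetric]
          greaterThanAtMost_def greaterThan_def atMost_def Collect_conj_eq)
    finally show ?thesis .
  qed
  have Isub: "I k \<subseteq> {0..}" for k by (auto simp: I_def)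
  have Isets: "I k \<in> sets (path_measure A \<omega>)" for k
  proof -
    have "I k \<in> sets borel" by (cases k) (simp_all add: I0 IS del: of_nat_Suc)
    then show ?thesis using Isub[of k] by (auto simp: sets_path_measure sets_restrict_space_iff)
  qed
  have em: "emeasure (path_measure A \<omega>) (I k) = ennreal (grid_increment A m k \<omega>)" for k
    by (cases k)
       (simp_all add: I0 IS emeasure_path_measure_Icc[OF A \<omega>] emeasure_path_measure_Ioc[OF A \<omega>]
          grid_increment_def divide_right_mono del: of_nat_Suc atLeastAtMost_singleton)
  have "(\<integral>\<^sup>+s. x (nat \<lceil>s * ?h\<rceil>) \<partial>path_measure A \<omega>)
      = (\<integral>\<^sup>+s. (\<Sum>k. x k * indicator (I k) s) \<partial>path_measure A \<omega>)"
  proof (rule nn_integral_cong)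
    fix s assume "s \<in> space (path_measure A \<omega>)"
    then have "s \<in> I (nat \<lceil>s * ?h\<rceil>)" by (simp add: I_def)
    moreover have "disjoint_family I" by (auto simp: disjoint_family_on_def I_def)
    ultimately show "x (nat \<lceil>s * ?h\<rceil>) = (\<Sum>k. x k * indicator (I k) s)"
      by (subst suminf_cmult_indicator) auto
  qed
  also have "\<dots> = (\<Sum>k. \<integral>\<^sup>+s. x k * indicator (I k) s \<partial>path_measure A \<omega>)"
    using Isets by (intro nn_integral_suminf) auto
  also have "\<dots> = (\<Sum>k. x k * ennreal (grid_increment A m k \<omega>))"
    using Isets by (simp add: nn_integral_cmult_indicator em)
  finally show ?thesis .
qed

section \<open>The dual optional projection of a pseudo-stopping time has total mass one\<close>

text \<open>
  Completeness spares any discussion of null sets, such as the set of paths on which \<open>A\<^sub>\<infinity>\<close> is infinite.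
\<close>

lemma (in complete_measure) measurable_if_AE_eq:
  assumes g: "g \<in> borel_measurable M" and "AE x in M. f x = g x"
  shows "f \<in> borel_measurable M"
proof (rule borel_measurableI)
  fix S :: "'b set" assume "open S"
  have S: "g -` S \<inter> space M \<in> sets M" using g \<open>open S\<close> by (auto intro: measurable_sets)
  have "AE x in M. x \<in> g -` S \<inter> space M \<longleftrightarrow> x \<in> f -` S \<inter> space M"
    using assms(2) by eventually_elim simp
  from in_sets_AE[OF this S] show "f -` S \<inter> space M \<in> sets M" by auto
qed

context usual_filtered_prob_space
begin

lemma adapted_total_mass_measurable:
  assumes "increasing_process M A" "adapted F A"
  shows "total_mass A \<in> borel_measurable M"
  by (rule total_mass_measurable[OF assms(1)])
     (use assms(2) in \<open>auto simp: adapted_def intro: measurable_F_imp_M\<close>)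

text \<open>
  On the interval that ends at the grid point \<open>t\<close> the integrand is \<open>X\<^sub>t\<close>, and the increment \<open>D\<close> of \<open>A\<close>
  over the interval is \<open>F\<^sub>t\<close>-measurable, so \<open>E[X\<^sub>t D] = E[Z D]\<close>. Summation over the intervals
  gives the total mass back.
\<close>

lemma nn_integral_grid_eq_terminal:
  assumes A: "increasing_process M A" "adapted F A"
    and fin: "(\<integral>\<^sup>+\<omega>. total_mass A \<omega> \<partial>M) < \<infinity>"
    and Z: "Z \<in> borel_measurable M" "\<And>\<omega>. \<omega> \<in> space M \<Longrightarrow> Z \<omega> \<in> {0..1}"
    and X: "unit_closed_martingale M F Z X"
  shows "(\<integral>\<^sup>+\<omega>. (\<integral>\<^sup>+s. ennreal (X (right_grid m s) \<omega>) \<partial>path_measure A \<omega>) \<partial>M)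
       = (\<integral>\<^sup>+\<omega>. ennreal (Z \<omega>) * total_mass A \<omega> \<partial>M)"
    and "(\<lambda>\<omega>. \<integral>\<^sup>+s. ennreal (X (right_grid m s) \<omega>) \<partial>path_measure A \<omega>) \<in> borel_measurable M"
proof -
  let ?h = "real (Suc m)"
  let ?D = "grid_increment A m"
  note [measurable] = Z(1)
  have AF: "A t \<in> borel_measurable (F t)" if "0 \<le> t" for t using A(2) that by (simp add: adapted_def)
  have Amono: "0 \<le> A s \<omega>" "A s \<omega> \<le> A t \<omega>" if "0 \<le> s" "s \<le> t" "\<omega> \<in> space M" for s t \<omega>
  proof -
    have "0 \<le> A 0 \<omega>" "mono_on {0..} (\<lambda>t. A t \<omega>)" using A(1) that by (auto simp: increasing_process_def)
    then show "0 \<le> A s \<omega>" "A s \<omega> \<le> A t \<omega>"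
      using that mono_onD[of "{0..}" "\<lambda>t. A t \<omega>" 0 s] mono_onD[of "{0..}" "\<lambda>t. A t \<omega>" s t] by auto
  qed
  have DF: "?D k \<in> borel_measurable (F (real k / ?h))" for k
  proof -
    have "A (real (k - 1) / ?h) \<in> borel_measurable (F (real k / ?h))"
      by (rule measurable_F_mono[OF AF]) (auto intro!: divide_right_mono)
    moreover have "A (real k / ?h) \<in> borel_measurable (F (real k / ?h))" by (rule AF) simp
    ultimately show ?thesis unfolding grid_increment_def by measurable
  qed
  have DM[measurable]: "?D k \<in> borel_measurable M" for k
    by (rule measurable_F_imp_M[OF DF]) simp
  have D0: "0 \<le> ?D k \<omega>" and DA: "?D k \<omega> \<le> A (real k / ?h) \<omega>" if "\<omega> \<in> space M" for k \<omega>
    using Amono[of "real (k - 1) / ?h" "real k / ?h" \<omega>] Amono[of "real k / ?h" "real k / ?h" \<omega>] that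
    by (auto simp: grid_increment_def divide_right_mono)
  have DI: "integrable M (?D k)" for k
  proof (rule integrableI_nonneg)
    have "(\<integral>\<^sup>+\<omega>. ennreal (?D k \<omega>) \<partial>M) \<le> (\<integral>\<^sup>+\<omega>. total_mass A \<omega> \<partial>M)"
    proof (rule nn_integral_mono)
      fix \<omega> assume \<omega>: "\<omega> \<in> space M"
      have "ennreal (?D k \<omega>) \<le> emeasure (path_measure A \<omega>) {0..real k / ?h}"
        using DA[OF \<omega>] by (simp add: emeasure_path_measure_Icc[OF A(1) \<omega>] ennreal_leI del: of_nat_Suc)
      also have "\<dots> \<le> total_mass A \<omega>"
        using sets.top[of "path_measure A \<omega>"] by (intro emeasure_mono) auto
      finally show "ennreal (?D k \<omega>) \<le> total_mass A \<omega>" .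
    qed
    with fin show "(\<integral>\<^sup>+\<omega>. ennreal (?D k \<omega>) \<partial>M) < \<infinity>" by (rule le_less_trans[rotated])
  qed (use D0 in auto)
  have DZ: "integrable M (\<lambda>\<omega>. ?D k \<omega> * Z \<omega>)" for k
  proof (rule Bochner_Integration.integrable_bound[OF DI])
    show "AE \<omega> in M. norm (?D k \<omega> * Z \<omega>) \<le> norm (?D k \<omega>)"
      using Z(2) by (intro AE_I2) (auto simp: abs_mult intro!: mult_left_le)
  qed (use Z in measurable)
  have X01: "X t \<omega> \<in> {0..1}" if "0 \<le> t" "\<omega> \<in> space M" for t \<omega>
    using X that by (auto simp: unit_closed_martingale_def)
  have XM[measurable]: "X (real k / ?h) \<in> borel_measurable M" for k
    by (rule measurable_F_imp_M[of _ "real k / ?h"]) (use X in \<open>auto simp: unit_closed_martingale_def\<close>)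
  have grid: "(\<integral>\<^sup>+s. ennreal (X (right_grid m s) \<omega>) \<partial>path_measure A \<omega>)
      = (\<Sum>k. ennreal (X (real k / ?h) \<omega>) * ennreal (?D k \<omega>))" if "\<omega> \<in> space M" for \<omega>
    unfolding right_grid_def by (rule nn_integral_path_measure_grid[OF A(1) that])
  have "(\<lambda>\<omega>. \<Sum>k. ennreal (X (real k / ?h) \<omega>) * ennreal (?D k \<omega>)) \<in> borel_measurable M"
    by measurable
  then show "(\<lambda>\<omega>. \<integral>\<^sup>+s. ennreal (X (right_grid m s) \<omega>) \<partial>path_measure A \<omega>) \<in> borel_measurable M"
    by (rule measurable_cong[THEN iffD2, rotated]) (rule grid)
  have step: "(\<integral>\<^sup>+\<omega>. ennreal (X (real k / ?h) \<omega>) * ennreal (?D k \<omega>) \<partial>M)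
      = (\<integral>\<^sup>+\<omega>. ennreal (Z \<omega>) * ennreal (?D k \<omega>) \<partial>M)" for k
  proof -
    note mart = unit_closed_martingale_integral[OF X _ Z(1) DF DZ, of k]
    have "(\<integral>\<^sup>+\<omega>. ennreal (X (real k / ?h) \<omega>) * ennreal (?D k \<omega>) \<partial>M)
        = (\<integral>\<^sup>+\<omega>. ennreal (?D k \<omega> * X (real k / ?h) \<omega>) \<partial>M)"
      using D0 X01 by (intro nn_integral_cong) (simp add: ennreal_mult' mult.commute)
    also have "\<dots> = ennreal (\<integral>\<omega>. ?D k \<omega> * X (real k / ?h) \<omega> \<partial>M)"
      using D0 X01 by (intro nn_integral_eq_integral mart AE_I2) auto
    also have "\<dots> = ennreal (\<integral>\<omega>. ?D k \<omega> * Z \<omega> \<partial>M)"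
      by (subst mart(2)) auto
    also have "\<dots> = (\<integral>\<^sup>+\<omega>. ennreal (?D k \<omega> * Z \<omega>) \<partial>M)"
      using D0 Z by (intro nn_integral_eq_integral[symmetric] DZ AE_I2) auto
    also have "\<dots> = (\<integral>\<^sup>+\<omega>. ennreal (Z \<omega>) * ennreal (?D k \<omega>) \<partial>M)"
      using D0 Z by (intro nn_integral_cong) (simp add: ennreal_mult' mult.commute)
    finally show ?thesis .
  qed
  have "(\<integral>\<^sup>+\<omega>. (\<integral>\<^sup>+s. ennreal (X (right_grid m s) \<omega>) \<partial>path_measure A \<omega>) \<partial>M)
      = (\<integral>\<^sup>+\<omega>. (\<Sum>k. ennreal (X (real k / ?h) \<omega>) * ennreal (?D k \<omega>)) \<partial>M)"
    by (intro nn_integral_cong grid)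
  also have "\<dots> = (\<Sum>k. \<integral>\<^sup>+\<omega>. ennreal (X (real k / ?h) \<omega>) * ennreal (?D k \<omega>) \<partial>M)"
    by (intro nn_integral_suminf) measurable
  also have "\<dots> = (\<Sum>k. \<integral>\<^sup>+\<omega>. ennreal (Z \<omega>) * ennreal (?D k \<omega>) \<partial>M)"
    by (simp only: step)
  also have "\<dots> = (\<integral>\<^sup>+\<omega>. (\<Sum>k. ennreal (Z \<omega>) * ennreal (?D k \<omega>)) \<partial>M)"
    by (intro nn_integral_suminf[symmetric]) measurable
  also have "\<dots> = (\<integral>\<^sup>+\<omega>. ennreal (Z \<omega>) * total_mass A \<omega> \<partial>M)"
  proof (rule nn_integral_cong)
    fix \<omega> assume "\<omega> \<in> space M"
    from nn_integral_path_measure_grid[OF A(1) this, of "\<lambda>_. ennreal (Z \<omega>)" m]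
    show "(\<Sum>k. ennreal (Z \<omega>) * ennreal (?D k \<omega>)) = ennreal (Z \<omega>) * total_mass A \<omega>"
      by simp
  qed
  finally show "(\<integral>\<^sup>+\<omega>. (\<integral>\<^sup>+s. ennreal (X (right_grid m s) \<omega>) \<partial>path_measure A \<omega>) \<partial>M)
       = (\<integral>\<^sup>+\<omega>. ennreal (Z \<omega>) * total_mass A \<omega> \<partial>M)" .
qed

text \<open>
  The mesh tends to zero. Dominated convergence is used twice: on almost every path, where \<open>dA\<close> is finite,
  and then on \<open>M\<close>, where the total mass is an integrable bound.
\<close>

lemma nn_integral_martingale_eq_terminal:
  assumes A: "increasing_process M A" "adapted F A"
    and fin: "(\<integral>\<^sup>+\<omega>. total_mass A \<omega> \<partial>M) < \<infinity>"
    and Z: "Z \<in> borel_measurable M" "\<And>\<omega>. \<omega> \<in> space M \<Longrightarrow> Z \<omega> \<in> {0..1}"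
    and X: "unit_closed_martingale M F Z X" "cadlag_process M X"
  shows "(\<integral>\<^sup>+\<omega>. (\<integral>\<^sup>+s. ennreal (X s \<omega>) \<partial>path_measure A \<omega>) \<partial>M)
       = (\<integral>\<^sup>+\<omega>. ennreal (Z \<omega>) * total_mass A \<omega> \<partial>M)"
    and "(\<lambda>\<omega>. \<integral>\<^sup>+s. ennreal (X s \<omega>) \<partial>path_measure A \<omega>) \<in> borel_measurable M"
proof -
  let ?f = "\<lambda>m \<omega>. \<integral>\<^sup>+s. ennreal (X (right_grid m s) \<omega>) \<partial>path_measure A \<omega>"
  note grid = nn_integral_grid_eq_terminal[OF A fin Z X(1)]
  note [measurable] = grid(2)
  have [measurable]: "total_mass A \<in> borel_measurable M"
    by (rule adapted_total_mass_measurable[OF A])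
  have X01: "X t \<omega> \<in> {0..1}" if "0 \<le> t" "\<omega> \<in> space M" for t \<omega>
    using X that by (auto simp: unit_closed_martingale_def)
  have gm: "0 \<le> right_grid m s" for m s by (simp add: right_grid_def)
  have bound: "?f m \<omega> \<le> total_mass A \<omega>" if "\<omega> \<in> space M" for m \<omega>
  proof -
    have "?f m \<omega> \<le> (\<integral>\<^sup>+s. 1 \<partial>path_measure A \<omega>)"
      using X01[OF gm that] by (intro nn_integral_mono) auto
    then show ?thesis by simp
  qed
  have lim: "AE \<omega> in M. (\<lambda>m. ?f m \<omega>) \<longlonglongrightarrow> (\<integral>\<^sup>+s. ennreal (X s \<omega>) \<partial>path_measure A \<omega>)"
  proof -
    have "AE \<omega> in M. total_mass A \<omega> \<noteq> \<infinity>"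
      using fin by (intro nn_integral_noteq_infinite) auto
    then show ?thesis using AE_space
    proof eventually_elim
      case (elim \<omega>)
      have cad: "cadlag (\<lambda>t. X t \<omega>)" using X(2) elim by (simp add: cadlag_process_def)
      show ?case
      proof (rule nn_integral_dominated_convergence[where w="\<lambda>_. 1"])
        show "(\<lambda>s. ennreal (X (right_grid m s) \<omega>)) \<in> borel_measurable (path_measure A \<omega>)" for m
          unfolding right_grid_def
          by (rule measurable_path_measure, rule measurable_compose[where N="count_space UNIV"
                and g="\<lambda>k. ennreal (X (real k / real (Suc m)) \<omega>)"]) measurable
        show "(\<lambda>s. ennreal (X s \<omega>)) \<in> borel_measurable (path_measure A \<omega>)"
          using cadlag_measurable_path[OF cad] by measurable
        show "AE s in path_measure A \<omega>. ennreal (X (right_grid m s) \<omega>) \<le> 1" for m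
          using X01[OF gm] elim by (intro AE_I2) auto
        show "(\<integral>\<^sup>+s. 1 \<partial>path_measure A \<omega>) < \<infinity>" using elim by (simp add: less_top)
        show "AE s in path_measure A \<omega>. (\<lambda>m. ennreal (X (right_grid m s) \<omega>)) \<longlonglongrightarrow> ennreal (X s \<omega>)"
          using cadlag_right_grid_tendsto[OF cad] by (intro AE_I2 tendsto_ennrealI) auto
      qed simp
    qed
  qed
  show meas: "(\<lambda>\<omega>. \<integral>\<^sup>+s. ennreal (X s \<omega>) \<partial>path_measure A \<omega>) \<in> borel_measurable M"
  proof (rule measurable_if_AE_eq)
    show "(\<lambda>\<omega>. liminf (\<lambda>m. ?f m \<omega>)) \<in> borel_measurable M" by measurable
    show "AE \<omega> in M. (\<integral>\<^sup>+s. ennreal (X s \<omega>) \<partial>path_measure A \<omega>) = liminf (\<lambda>m. ?f m \<omega>)"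
      using lim by eventually_elim (simp add: lim_imp_Liminf)
  qed
  have "(\<lambda>m. \<integral>\<^sup>+\<omega>. ?f m \<omega> \<partial>M) \<longlonglongrightarrow> (\<integral>\<^sup>+\<omega>. (\<integral>\<^sup>+s. ennreal (X s \<omega>) \<partial>path_measure A \<omega>) \<partial>M)"
    using bound by (intro nn_integral_dominated_convergence[OF _ meas _ _ fin lim]) auto
  moreover have "(\<integral>\<^sup>+\<omega>. ?f m \<omega> \<partial>M) = (\<integral>\<^sup>+\<omega>. ennreal (Z \<omega>) * total_mass A \<omega> \<partial>M)" for m
    by (rule grid(1))
  ultimately show "(\<integral>\<^sup>+\<omega>. (\<integral>\<^sup>+s. ennreal (X s \<omega>) \<partial>path_measure A \<omega>) \<partial>M)
       = (\<integral>\<^sup>+\<omega>. ennreal (Z \<omega>) * total_mass A \<omega> \<partial>M)"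
    by (simp add: LIMSEQ_const_iff)
qed

lemma integral_path_eq_enn2real:
  assumes X: "unit_closed_martingale M F Z X" "cadlag_process M X" and \<omega>: "\<omega> \<in> space M"
  shows "(\<integral>s. X s \<omega> \<partial>path_measure A \<omega>) = enn2real (\<integral>\<^sup>+s. ennreal (X s \<omega>) \<partial>path_measure A \<omega>)"
  using X \<omega> by (intro integral_eq_nn_integral cadlag_measurable_path AE_I2)
     (auto simp: cadlag_process_def unit_closed_martingale_def)

text \<open>
  The defining identity of \<open>A\<close> for the constant process \<open>1\<close>, which at time \<open>\<rho>\<close> takes the value
  \<open>1\<close> almost surely because \<open>\<rho>\<close> is finite.
\<close>

lemma expectation_total_mass:
  assumes \<rho>: "\<rho> \<in> borel_measurable M"
    and fin_\<rho>: "measure M {\<omega> \<in> space M. \<rho> \<omega> = \<infinity>} = 0"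
    and A: "dual_optional_projection M F \<rho> A"
  shows "(\<integral>\<^sup>+\<omega>. total_mass A \<omega> \<partial>M) = 1"
proof -
  have fin: "(\<integral>\<^sup>+\<omega>. total_mass A \<omega> \<partial>M) < \<infinity>" and inc: "increasing_process M A" "adapted F A"
    using A by (auto simp: dual_optional_projection_def)
  have [measurable]: "total_mass A \<in> borel_measurable M"
    by (rule adapted_total_mass_measurable[OF inc])
  have ae: "AE \<omega> in M. total_mass A \<omega> \<noteq> \<infinity>"
    using fin by (intro nn_integral_noteq_infinite) auto
  have "optional_process M F (\<lambda>_ _. 1::real)"
    by (rule cadlag_adapted_optional) (auto simp: adapted_def cadlag_process_def cadlag_def intro!: exI[of _ 1])
  moreover have "bounded_process M (\<lambda>_ _. 1)" by (auto simp: bounded_process_def intro!: exI[of _ 1])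
  ultimately have "(\<integral>\<omega>. sample (\<lambda>_ _. 1::real) (\<rho> \<omega>) \<omega> \<partial>M) = (\<integral>\<omega>. (\<integral>s. 1 \<partial>path_measure A \<omega>) \<partial>M)"
    using A unfolding dual_optional_projection_def by blast
  also have "\<dots> = (\<integral>\<omega>. enn2real (total_mass A \<omega>) \<partial>M)"
    by (intro Bochner_Integration.integral_cong) (simp_all add: measure_def)
  also have "(\<integral>\<omega>. sample (\<lambda>_ _. 1::real) (\<rho> \<omega>) \<omega> \<partial>M) = (\<integral>\<omega>. 1 - indicator {\<omega> \<in> space M. \<rho> \<omega> = \<infinity>} \<omega> \<partial>M)"
    by (intro Bochner_Integration.integral_cong) (auto simp: sample_def indicator_def)
  also have "\<dots> = 1"
    using \<rho> by (subst Bochner_Integration.integral_diff) (auto simp: prob_space fin_\<rho>[unfolded infinity_ennreal_def] less_top[symmetric])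
  finally have one: "(\<integral>\<omega>. enn2real (total_mass A \<omega>) \<partial>M) = 1" ..
  have "(\<integral>\<^sup>+\<omega>. total_mass A \<omega> \<partial>M) = (\<integral>\<^sup>+\<omega>. ennreal (enn2real (total_mass A \<omega>)) \<partial>M)"
    using ae by (intro nn_integral_cong_AE) (auto elim!: eventually_mono simp: less_top)
  also have "\<dots> = ennreal (\<integral>\<omega>. enn2real (total_mass A \<omega>) \<partial>M)"
  proof (rule nn_integral_eq_integral)
    show "integrable M (\<lambda>\<omega>. enn2real (total_mass A \<omega>))"
      by (rule ccontr) (use one in \<open>simp add: not_integrable_integral_eq\<close>)
  qed simp
  finally show ?thesis using one by simp
qed

text \<open>
  The pseudo-stopping time property is applied to the cadlag martingale closed by the indicator of
  \<open>B = {A\<^sub>\<infinity> > 1}\<close>. The resulting identity \<open>P(B) = E[1\<^sub>B A\<^sub>\<infinity>]\<close> yields \<open>A\<^sub>\<infinity> \<le> 1\<close>,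
  and with \<open>E[A\<^sub>\<infinity>] = 1\<close> equality follows.
\<close>

lemma total_mass_eq_1:
  assumes pst: "pseudo_stopping_time M F \<rho>"
    and fin_\<rho>: "measure M {\<omega> \<in> space M. \<rho> \<omega> = \<infinity>} = 0"
    and A: "dual_optional_projection M F \<rho> A"
  shows "AE \<omega> in M. total_mass A \<omega> = 1"
proof -
  have \<rho>: "\<rho> \<in> borel_measurable M" using pst by (simp add: pseudo_stopping_time_def)
  have E1: "(\<integral>\<^sup>+\<omega>. total_mass A \<omega> \<partial>M) = 1" by (rule expectation_total_mass[OF \<rho> fin_\<rho> A])
  then have fin: "(\<integral>\<^sup>+\<omega>. total_mass A \<omega> \<partial>M) < \<infinity>" by simp
  have inc: "increasing_process M A" "adapted F A"
    using A by (auto simp: dual_optional_projection_def)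
  have [measurable]: "total_mass A \<in> borel_measurable M"
    by (rule adapted_total_mass_measurable[OF inc])
  define B where "B = {\<omega>\<in>space M. 1 < total_mass A \<omega>}"
  have [measurable]: "B \<in> sets M" unfolding B_def by measurable
  let ?Z = "indicator B :: 'a \<Rightarrow> real"
  have Z: "?Z \<in> borel_measurable M" "\<And>\<omega>. \<omega> \<in> space M \<Longrightarrow> ?Z \<omega> \<in> {0..1}"
    by (auto simp: indicator_def)
  obtain X where X: "unit_closed_martingale M F ?Z X" "cadlag_process M X"
    using cadlag_version_exists[OF Z] by blast
  have mart: "cadlag_martingale M F X" by (rule unit_closed_martingale_imp_cadlag_martingale[OF Z X])
  have X01: "X t \<omega> \<in> {0..1}" if "0 \<le> t" "\<omega> \<in> space M" for t \<omega>
    using X that by (auto simp: unit_closed_martingale_def)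
  have opt: "optional_process M F X"
    using mart by (intro cadlag_adapted_optional) (auto simp: cadlag_martingale_def)
  have bdd: "bounded_process M X"
    using X01 by (auto simp: bounded_process_def intro!: exI[of _ 1])
  have "(\<integral>\<^sup>+\<omega>. (SUP t\<in>{0..}. ennreal \<bar>X t \<omega>\<bar>) \<partial>M) \<le> (\<integral>\<^sup>+\<omega>. 1 \<partial>M)"
    using X01 by (intro nn_integral_mono SUP_least) auto
  also have "\<dots> < \<infinity>" by (simp add: emeasure_space_1)
  finally have "(\<integral>\<omega>. limit_sample X \<rho> \<omega> \<partial>M) = (\<integral>\<omega>. X 0 \<omega> \<partial>M)"
    using pst mart unfolding pseudo_stopping_time_def by blast
  also have "\<dots> = (\<integral>\<omega>. 1 * ?Z \<omega> \<partial>M)"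
    using unit_closed_martingale_integral(2)[OF X(1) order_refl Z(1), of "\<lambda>_. 1"] by (simp add: less_top[symmetric])
  also have "\<dots> = measure M B" by simp
  finally have 1: "(\<integral>\<omega>. limit_sample X \<rho> \<omega> \<partial>M) = measure M B" .
  have samp: "(\<lambda>\<omega>. sample X (\<rho> \<omega>) \<omega>) \<in> borel_measurable M"
    by (rule sample_at_random_time_measurable[OF opt \<rho>])
  have "{\<omega> \<in> space M. \<rho> \<omega> = \<infinity>} \<in> null_sets M"
    using fin_\<rho> \<rho> by (intro null_setsI) (auto simp: emeasure_eq_measure)
  then have "AE \<omega> in M. \<rho> \<omega> \<noteq> \<infinity>" using AE_not_in AE_space by fastforce
  then have ae: "AE \<omega> in M. limit_sample X \<rho> \<omega> = sample X (\<rho> \<omega>) \<omega>"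
    by eventually_elim (simp add: limit_sample_def sample_def)
  have 2: "(\<integral>\<omega>. sample X (\<rho> \<omega>) \<omega> \<partial>M) = measure M B"
    using integral_cong_AE[OF measurable_if_AE_eq[OF samp ae] samp ae] 1 by simp
  note dual = nn_integral_martingale_eq_terminal[OF inc fin Z X]
  note [measurable] = dual(2)
  let ?f = "\<lambda>\<omega>. \<integral>\<^sup>+s. ennreal (X s \<omega>) \<partial>path_measure A \<omega>"
  have le: "(\<integral>\<^sup>+\<omega>. ennreal (?Z \<omega>) * total_mass A \<omega> \<partial>M) \<le> (\<integral>\<^sup>+\<omega>. total_mass A \<omega> \<partial>M)"
    by (intro nn_integral_mono) (auto simp: indicator_def)
  then have finf: "(\<integral>\<^sup>+\<omega>. ?f \<omega> \<partial>M) < \<infinity>" using fin dual(1) by simp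
  then have "AE \<omega> in M. ?f \<omega> \<noteq> \<infinity>" by (intro nn_integral_noteq_infinite) auto
  then have eq: "AE \<omega> in M. ennreal (enn2real (?f \<omega>)) = ?f \<omega>" by eventually_elim (simp add: less_top)
  have "measure M B = (\<integral>\<omega>. (\<integral>s. X s \<omega> \<partial>path_measure A \<omega>) \<partial>M)"
    using A opt bdd unfolding dual_optional_projection_def 2[symmetric] by blast
  also have "\<dots> = (\<integral>\<omega>. enn2real (?f \<omega>) \<partial>M)"
    by (intro Bochner_Integration.integral_cong integral_path_eq_enn2real[OF X]) auto
  also have "\<dots> = enn2real (\<integral>\<^sup>+\<omega>. ennreal (enn2real (?f \<omega>)) \<partial>M)"
    by (intro integral_eq_nn_integral) auto
  also have "(\<integral>\<^sup>+\<omega>. ennreal (enn2real (?f \<omega>)) \<partial>M) = (\<integral>\<^sup>+\<omega>. ?f \<omega> \<partial>M)"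
    by (rule nn_integral_cong_AE[OF eq])
  finally have "emeasure M B = (\<integral>\<^sup>+\<omega>. ?f \<omega> \<partial>M)"
    using finf by (simp add: emeasure_eq_measure less_top)
  also have "\<dots> = (\<integral>\<^sup>+\<omega>. ennreal (?Z \<omega>) * total_mass A \<omega> \<partial>M)"
    by (rule dual(1))
  also have "\<dots> = (\<integral>\<^sup>+\<omega>. indicator B \<omega> * (total_mass A \<omega> - 1) + indicator B \<omega> \<partial>M)"
    by (intro nn_integral_cong) (auto simp: indicator_def B_def diff_add_cancel_ennreal)
  also have "\<dots> = (\<integral>\<^sup>+\<omega>. indicator B \<omega> * (total_mass A \<omega> - 1) \<partial>M) + emeasure M B"
    by (subst nn_integral_add) auto
  finally have "emeasure M B + 0 = emeasure M B + (\<integral>\<^sup>+\<omega>. indicator B \<omega> * (total_mass A \<omega> - 1) \<partial>M)"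
    by (simp add: add.commute)
  then have "(\<integral>\<^sup>+\<omega>. indicator B \<omega> * (total_mass A \<omega> - 1) \<partial>M) = 0"
    unfolding ennreal_add_left_cancel by (simp add: emeasure_eq_measure)
  then have "AE \<omega> in M. indicator B \<omega> * (total_mass A \<omega> - 1) = 0"
    by (subst (asm) nn_integral_0_iff_AE) auto
  then have le1: "AE \<omega> in M. total_mass A \<omega> \<le> 1" using AE_space
    by eventually_elim (auto simp: B_def indicator_def not_less[symmetric] diff_eq_0_iff_ennreal split: if_splits)
  have "(\<integral>\<^sup>+\<omega>. 1 - total_mass A \<omega> \<partial>M) = 0"
    using E1 le1 by (subst nn_integral_diff) (auto simp: emeasure_space_1)
  then have "AE \<omega> in M. 1 - total_mass A \<omega> = 0"
    by (subst (asm) nn_integral_0_iff_AE) auto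
  with le1 show ?thesis
    by eventually_elim (auto simp: diff_eq_0_iff_ennreal intro: antisym)
qed

end

section \<open>The Foellmer measure of an adapted process of total mass one\<close>

text \<open>
  Moving \<open>dA(\<omega>)\<close> to the Borel sets of the line, and replacing it on the exceptional set by a point mass,
  makes it a probability kernel in the sense of the Giry monad. Nothing changes almost surely.
\<close>

definition path_kernel :: "(real \<Rightarrow> 'a \<Rightarrow> real) \<Rightarrow> 'a \<Rightarrow> real measure" where
  "path_kernel A \<omega> =
     (if total_mass A \<omega> = 1 then distr (path_measure A \<omega>) borel (\<lambda>s. s) else return borel 0)"

text \<open>
  It suffices to test the half-lines, on which the kernel is given by the distribution function \<open>A\<^sub>t\<close>.
\<close>

lemma path_kernel_measurable:
  assumes A: "increasing_process M A" and AM: "\<And>t. 0 \<le> t \<Longrightarrow> A t \<in> borel_measurable M"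
  shows "path_kernel A \<in> measurable M (prob_algebra borel)"
proof (rule measurable_prob_algebra_generated)
  show "sets (borel :: real measure) = sigma_sets UNIV (range (\<lambda>a. {..a}))"
    by (subst borel_eq_atMost) auto
  show "Int_stable (range (\<lambda>a::real. {..a}))"
    by (auto simp: Int_stable_def)
  have [measurable]: "total_mass A \<in> borel_measurable M" by (rule total_mass_measurable[OF A AM])
  have [measurable]: "(\<lambda>s. s) \<in> measurable (path_measure A \<omega>) borel" for \<omega>
    by (rule measurable_path_measure) simp
  show "prob_space (path_kernel A \<omega>)" for \<omega>
  proof (cases "total_mass A \<omega> = 1")
    case True
    then interpret prob_space "path_measure A \<omega>" by (intro prob_spaceI) simp
    show ?thesis using True by (simp add: path_kernel_def prob_space_distr)
  qed (simp add: path_kernel_def prob_space_return)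
  show "sets (path_kernel A \<omega>) = sets borel" for \<omega>
    by (simp add: path_kernel_def)
  fix S :: "real set" assume "S \<in> range (\<lambda>a. {..a})"
  then obtain t where S: "S = {..t}" by auto
  have "emeasure (path_kernel A \<omega>) S
      = (if total_mass A \<omega> = 1 then if t < 0 then 0 else ennreal (A (max 0 t) \<omega>) else indicator S 0)"
    if "\<omega> \<in> space M" for \<omega>
  proof -
    have "{..t} \<inter> {0..} = (if t < 0 then {} else {0..t})" by auto
    then show ?thesis
      by (simp add: path_kernel_def S emeasure_distr vimage_def Int_def[symmetric]
          emeasure_path_measure_Icc[OF A that])
  qed
  then show "(\<lambda>\<omega>. emeasure (path_kernel A \<omega>) S) \<in> borel_measurable M"
    by (rule measurable_cong[THEN iffD2]) (use AM[of "max 0 t"] in measurable)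
qed simp

lemma nn_integral_path_kernel:
  "total_mass A \<omega> = 1 \<Longrightarrow> f \<in> borel_measurable borel \<Longrightarrow>
    (\<integral>\<^sup>+s. f s \<partial>path_kernel A \<omega>) = (\<integral>\<^sup>+s. f s \<partial>path_measure A \<omega>)"
  by (simp add: path_kernel_def nn_integral_distr measurable_path_measure)

lemma integral_path_kernel:
  fixes f :: "real \<Rightarrow> real"
  shows "total_mass A \<omega> = 1 \<Longrightarrow> f \<in> borel_measurable borel \<Longrightarrow>
    (\<integral>s. f s \<partial>path_kernel A \<omega>) = (\<integral>s. f s \<partial>path_measure A \<omega>)"
  by (simp add: path_kernel_def integral_distr measurable_path_measure)

definition graph_kernel :: "'a measure \<Rightarrow> (real \<Rightarrow> 'a \<Rightarrow> real) \<Rightarrow> 'a \<Rightarrow> (ennreal \<times> 'a) measure" where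
  "graph_kernel M A \<omega> = distr (path_kernel A \<omega>) (borel \<Otimes>\<^sub>M M) (\<lambda>s. (ennreal s, \<omega>))"

locale unit_mass_process = usual_filtered_prob_space M F
  for M :: "'a measure" and F +
  fixes A :: "real \<Rightarrow> 'a \<Rightarrow> real"
  assumes inc: "increasing_process M A" and adap: "adapted F A"
    and mass: "AE \<omega> in M. total_mass A \<omega> = 1"
begin

lemma A_measurable: "0 \<le> t \<Longrightarrow> A t \<in> borel_measurable M"
  using adap by (auto simp: adapted_def intro: measurable_F_imp_M)

lemma kernel_measurable[measurable]: "path_kernel A \<in> measurable M (prob_algebra borel)"
  by (rule path_kernel_measurable[OF inc A_measurable])

lemma graph_kernel_measurable[measurable]:
  "graph_kernel M A \<in> measurable M (prob_algebra (borel \<Otimes>\<^sub>M M))"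
  unfolding graph_kernel_def[abs_def] by measurable

lemma graph_measurable[measurable]:
  "\<omega> \<in> space M \<Longrightarrow> (\<lambda>s. (ennreal s, \<omega>)) \<in> measurable (path_kernel A \<omega>) (borel \<Otimes>\<^sub>M M)"
  "\<omega> \<in> space M \<Longrightarrow> (\<lambda>s. (ennreal s, \<omega>)) \<in> measurable borel (borel \<Otimes>\<^sub>M M)"
proof -
  show *: "\<omega> \<in> space M \<Longrightarrow> (\<lambda>s. (ennreal s, \<omega>)) \<in> measurable borel (borel \<Otimes>\<^sub>M M)" by measurable
  have "sets (path_kernel A \<omega>) = sets borel" by (simp add: path_kernel_def)
  from measurable_cong_sets[OF this refl] *
  show "\<omega> \<in> space M \<Longrightarrow> (\<lambda>s. (ennreal s, \<omega>)) \<in> measurable (path_kernel A \<omega>) (borel \<Otimes>\<^sub>M M)" by blast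
qed

lemma nn_integral_graph_kernel:
  assumes X: "X \<in> borel_measurable (borel \<Otimes>\<^sub>M M)"
  shows "AE \<omega> in M. (\<integral>\<^sup>+z. X z \<partial>graph_kernel M A \<omega>) = (\<integral>\<^sup>+s. X (ennreal s, \<omega>) \<partial>path_measure A \<omega>)"
  using mass AE_space
proof eventually_elim
  case (elim \<omega>)
  note [measurable] = X
  have "(\<integral>\<^sup>+z. X z \<partial>graph_kernel M A \<omega>) = (\<integral>\<^sup>+s. X (ennreal s, \<omega>) \<partial>path_kernel A \<omega>)"
    unfolding graph_kernel_def using elim by (intro nn_integral_distr graph_measurable) auto
  also have "\<dots> = (\<integral>\<^sup>+s. X (ennreal s, \<omega>) \<partial>path_measure A \<omega>)"
    using measurable_compose[OF graph_measurable(2) X] elim by (intro nn_integral_path_kernel) auto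
  finally show ?case .
qed

lemma M_prob_algebra: "M \<in> space (prob_algebra M)"
  by (simp add: space_prob_algebra prob_space_axioms)

text \<open>
  The Foellmer measure is defined through its values on measurable sets. Identifying these with the values
  of a composition of kernels shows at once that they are countably additive.
\<close>

lemma follmer_measure_eq_bind: "follmer_measure M A = M \<bind> graph_kernel M A"
proof -
  let ?\<nu> = "M \<bind> graph_kernel M A"
  have sets_\<nu>: "sets ?\<nu> = sets (borel \<Otimes>\<^sub>M M)"
    by (rule sets_bind'[OF M_prob_algebra]) measurable
  have space_\<nu>: "space ?\<nu> = UNIV \<times> space M"
    using sets_eq_imp_space_eq[OF sets_\<nu>] by (simp add: space_pair_measure)
  have "?\<nu> = measure_of (UNIV \<times> space M) (sets (borel \<Otimes>\<^sub>M M)) (emeasure ?\<nu>)"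
    using measure_of_of_measure[of ?\<nu>] by (simp add: sets_\<nu> space_\<nu>)
  also have "\<dots> = follmer_measure M A"
    unfolding follmer_measure_def
  proof (rule measure_of_eq)
    show "sets (borel \<Otimes>\<^sub>M M) \<subseteq> Pow (UNIV \<times> space M)"
      using sets.space_closed[of "borel \<Otimes>\<^sub>M M"] by (simp add: space_pair_measure)
    fix B :: "(ennreal \<times> 'a) set" assume "B \<in> sigma_sets (UNIV \<times> space M) (sets (borel \<Otimes>\<^sub>M M))"
    then have B: "B \<in> sets (borel \<Otimes>\<^sub>M M)"
      using sets.sigma_sets_eq[of "(borel :: ennreal measure) \<Otimes>\<^sub>M M"] by (simp add: space_pair_measure)
    have "emeasure ?\<nu> B = (\<integral>\<^sup>+\<omega>. emeasure (graph_kernel M A \<omega>) B \<partial>M)"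
      by (rule emeasure_bind_prob_algebra[OF M_prob_algebra _ B]) measurable
    also have "\<dots> = (\<integral>\<^sup>+\<omega>. (\<integral>\<^sup>+z. indicator B z \<partial>graph_kernel M A \<omega>) \<partial>M)"
      using B by (simp add: graph_kernel_def)
    also have "\<dots> = (\<integral>\<^sup>+\<omega>. (\<integral>\<^sup>+s. indicator B (ennreal s, \<omega>) \<partial>path_measure A \<omega>) \<partial>M)"
      using B by (intro nn_integral_cong_AE nn_integral_graph_kernel) auto
    finally show "emeasure ?\<nu> B = stieltjes_expectation M A (\<lambda>_. 0) (indicator B)"
      by (simp add: stieltjes_expectation_def)
  qed
  finally show ?thesis ..
qed

lemma sets_follmer_measure: "sets (follmer_measure M A) = sets (borel \<Otimes>\<^sub>M M)"
  unfolding follmer_measure_eq_bind by (rule sets_bind'[OF M_prob_algebra]) measurable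

lemma nn_integral_follmer_measure:
  assumes X: "X \<in> borel_measurable (borel \<Otimes>\<^sub>M M)"
  shows "(\<integral>\<^sup>+z. X z \<partial>follmer_measure M A) = (\<integral>\<^sup>+\<omega>. (\<integral>\<^sup>+s. X (ennreal s, \<omega>) \<partial>path_measure A \<omega>) \<partial>M)"
  unfolding follmer_measure_eq_bind
  by (subst nn_integral_bind[OF X measurable_prob_algebraD[OF graph_kernel_measurable]])
     (intro nn_integral_cong_AE nn_integral_graph_kernel X)

lemma prob_space_follmer_measure: "prob_space (follmer_measure M A)"
  unfolding follmer_measure_eq_bind by (rule prob_space_bind'[OF M_prob_algebra]) measurable

lemma integral_follmer_measure:
  fixes X :: "ennreal \<times> 'a \<Rightarrow> real"
  assumes X: "X \<in> borel_measurable (borel \<Otimes>\<^sub>M M)" and bdd: "\<And>z. z \<in> UNIV \<times> space M \<Longrightarrow> \<bar>X z\<bar> \<le> K"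
  shows "(\<integral>z. X z \<partial>follmer_measure M A) = (\<integral>\<omega>. (\<integral>s. X (ennreal s, \<omega>) \<partial>path_measure A \<omega>) \<partial>M)"
proof -
  let ?S = "subprob_algebra (borel \<Otimes>\<^sub>M M) :: (ennreal \<times> 'a) measure measure"
  note gk = measurable_prob_algebraD[OF graph_kernel_measurable]
  note [measurable] = X
  have "(\<integral>z. X z \<partial>follmer_measure M A) = (\<integral>N. (\<integral>z. X z \<partial>N) \<partial>distr M ?S (graph_kernel M A))"
    unfolding follmer_measure_eq_bind bind_nonempty''[OF gk not_empty]
  proof (rule integral_join[where B=K and B'=1])
    show "finite_measure (distr M ?S (graph_kernel M A))" by (rule finite_measure_distr[OF gk])
    have "AE \<omega> in M. emeasure (graph_kernel M A \<omega>) (space (graph_kernel M A \<omega>)) \<le> ennreal 1"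
      using measurable_space[OF gk]
      by (intro AE_I2) (auto simp: space_subprob_algebra intro: subprob_space.emeasure_space_le_1)
    then show "AE N in distr M ?S (graph_kernel M A). emeasure N (space N) \<le> ennreal 1"
      by (subst AE_distr_iff[OF gk]) (auto intro!: measurable_sets_Collect)
  qed (use bdd in \<open>auto simp: space_pair_measure\<close>)
  also have "\<dots> = (\<integral>\<omega>. (\<integral>z. X z \<partial>graph_kernel M A \<omega>) \<partial>M)"
    by (rule integral_distr[OF gk]) measurable
  also have "\<dots> = (\<integral>\<omega>. (\<integral>s. X (ennreal s, \<omega>) \<partial>path_measure A \<omega>) \<partial>M)"
  proof (rule integral_cong_AE)
    show m: "(\<lambda>\<omega>. \<integral>z. X z \<partial>graph_kernel M A \<omega>) \<in> borel_measurable M"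
      by (rule measurable_compose[OF gk integral_measurable_subprob_algebra[OF X]])
    show ae: "AE \<omega> in M. (\<integral>z. X z \<partial>graph_kernel M A \<omega>) = (\<integral>s. X (ennreal s, \<omega>) \<partial>path_measure A \<omega>)"
      using mass AE_space
    proof eventually_elim
      case (elim \<omega>)
      have "(\<integral>z. X z \<partial>graph_kernel M A \<omega>) = (\<integral>s. X (ennreal s, \<omega>) \<partial>path_kernel A \<omega>)"
        unfolding graph_kernel_def using elim by (intro integral_distr graph_measurable) auto
      also have "\<dots> = (\<integral>s. X (ennreal s, \<omega>) \<partial>path_measure A \<omega>)"
        using measurable_compose[OF graph_measurable(2) X] elim by (intro integral_path_kernel) auto
      finally show ?case .
    qed
    then show "(\<lambda>\<omega>. \<integral>s. X (ennreal s, \<omega>) \<partial>path_measure A \<omega>) \<in> borel_measurable M"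
      by (intro measurable_if_AE_eq[OF m]) (auto elim!: eventually_mono)
  qed
  finally show ?thesis .
qed

lemma randomized_stopping_time_follmer_measure: "randomized_stopping_time M F (follmer_measure M A)"
  unfolding randomized_stopping_time_def randomized_random_variable_def
proof (intro conjI exI)
  show "prob_space (follmer_measure M A)" "sets (follmer_measure M A) = sets (borel \<Otimes>\<^sub>M M)"
    by (rule prob_space_follmer_measure, rule sets_follmer_measure)
  show "adapted F A" by (rule adap)
  show "follmer_representation M (follmer_measure M A) A (\<lambda>_. 0)"
    unfolding follmer_representation_def stieltjes_expectation_def
    using inc A_measurable by (auto simp: nn_integral_follmer_measure)
  have [measurable]: "snd \<in> measurable (follmer_measure M A) M"
    unfolding measurable_cong_sets[OF sets_follmer_measure refl] by measurable
  show "distr (follmer_measure M A) M snd = M"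
  proof (rule measure_eqI)
    fix B assume "B \<in> sets (distr (follmer_measure M A) M snd)"
    then have B[measurable]: "B \<in> sets M" by simp
    have "emeasure (distr (follmer_measure M A) M snd) B
        = (\<integral>\<^sup>+z. indicator B (snd z) \<partial>follmer_measure M A)"
      by (simp flip: nn_integral_indicator add: nn_integral_distr)
    also have "\<dots> = (\<integral>\<^sup>+\<omega>. (\<integral>\<^sup>+s. indicator B \<omega> \<partial>path_measure A \<omega>) \<partial>M)"
      by (subst nn_integral_follmer_measure) (auto, measurable)
    also have "\<dots> = (\<integral>\<^sup>+\<omega>. indicator B \<omega> \<partial>M)"
      using mass by (intro nn_integral_cong_AE) (auto elim!: eventually_mono)
    finally show "emeasure (distr (follmer_measure M A) M snd) B = emeasure M B"
      by simp
  qed simp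
qed

text \<open>
  The kernel charges finite times only, where \<open>sample\<close> is the process itself; the identity is then the
  defining property of the dual optional projection.
\<close>

lemma integral_sample_follmer_measure:
  fixes X :: "real \<Rightarrow> 'a \<Rightarrow> real"
  assumes X: "optional_process M F X" "bounded_process M X"
    and dual: "dual_optional_projection M F \<rho> A"
  shows "(\<integral>(t, \<omega>). sample X t \<omega> \<partial>follmer_measure M A) = (\<integral>\<omega>. sample X (\<rho> \<omega>) \<omega> \<partial>M)"
proof -
  obtain K where K: "\<And>t \<omega>. 0 \<le> t \<Longrightarrow> \<omega> \<in> space M \<Longrightarrow> \<bar>X t \<omega>\<bar> \<le> K"
    using X(2) by (auto simp: bounded_process_def)
  have "(\<integral>(t, \<omega>). sample X t \<omega> \<partial>follmer_measure M A)
      = (\<integral>\<omega>. (\<integral>s. (case (ennreal s, \<omega>) of (t, \<omega>) \<Rightarrow> sample X t \<omega>) \<partial>path_measure A \<omega>) \<partial>M)"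
    by (rule integral_follmer_measure[OF sample_measurable[OF X(1)], where K="max K 0"])
       (auto simp: sample_def le_max_iff_disj K)
  also have "\<dots> = (\<integral>\<omega>. (\<integral>s. X s \<omega> \<partial>path_measure A \<omega>) \<partial>M)"
    by (intro Bochner_Integration.integral_cong) (auto simp: sample_def)
  also have "\<dots> = (\<integral>\<omega>. sample X (\<rho> \<omega>) \<omega> \<partial>M)"
    using dual X by (auto simp: dual_optional_projection_def)
  finally show ?thesis .
qed

text \<open>
  Truncation at level \<open>n\<close> gives a bounded real-valued optional process, and monotone convergence removes
  the truncation.
\<close>

lemma nn_integral_sample_follmer_measure:
  fixes X :: "real \<Rightarrow> 'a \<Rightarrow> ennreal"
  assumes X: "optional_process M F X"
    and \<rho>: "\<rho> \<in> borel_measurable M"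
    and dual: "dual_optional_projection M F \<rho> A"
  shows "(\<integral>\<^sup>+(t, \<omega>). sample X t \<omega> \<partial>follmer_measure M A) = (\<integral>\<^sup>+\<omega>. sample X (\<rho> \<omega>) \<omega> \<partial>M)"
proof -
  interpret \<mu>: prob_space "follmer_measure M A" by (rule prob_space_follmer_measure)
  define Y where "Y n t \<omega> = enn2real (min (X t \<omega>) (of_nat n))" for n t \<omega>
  have Yopt: "optional_process M F (Y n)" for n
    using X unfolding optional_process_def Y_def case_prod_beta by measurable
  have Yn: "0 \<le> Y n t \<omega> \<and> Y n t \<omega> \<le> real n" for n t \<omega>
    unfolding Y_def by (auto simp: enn2real_leI ennreal_of_nat_eq_real_of_nat)
  then have Ybdd: "bounded_process M (Y n)" for n
    by (auto simp: bounded_process_def intro!: exI[of _ "real n"])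
  have sY: "0 \<le> sample (Y n) t \<omega>" "\<bar>sample (Y n) t \<omega>\<bar> \<le> real n" for n t \<omega>
    using Yn by (auto simp: sample_def)
  have mY: "ennreal (sample (Y n) t \<omega>) = min (sample X t \<omega>) (of_nat n)" for n t \<omega>
  proof -
    have "min (X (enn2real t) \<omega>) (of_nat n) < top"
      by (rule le_less_trans[OF min.cobounded2]) (simp add: of_nat_less_top)
    then show ?thesis by (simp add: sample_def Y_def)
  qed
  have SUP: "(SUP n. min x (of_nat n)) = x" for x :: ennreal
    using inf_SUP[of x "of_nat" "UNIV :: nat set"] by (simp add: inf_min ennreal_SUP_of_nat_eq_top)
  have inc_min: "incseq (\<lambda>n z. min (g z) (of_nat n))" for g :: "'b \<Rightarrow> ennreal"
    by (auto simp: incseq_def le_fun_def intro: min.coboundedI2)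
  have sX\<mu>: "(\<lambda>(t, \<omega>). sample X t \<omega>) \<in> borel_measurable (follmer_measure M A)"
    unfolding measurable_cong_sets[OF sets_follmer_measure refl] by (rule sample_measurable[OF X])
  have sY\<mu>: "(\<lambda>(t, \<omega>). sample (Y n) t \<omega>) \<in> borel_measurable (follmer_measure M A)" for n
    unfolding measurable_cong_sets[OF sets_follmer_measure refl] by (rule sample_measurable[OF Yopt])
  note sX\<rho> = sample_at_random_time_measurable[OF X \<rho>]
  note sY\<rho> = sample_at_random_time_measurable[OF Yopt \<rho>]
  have eq: "(\<integral>\<^sup>+z. min (case z of (t, \<omega>) \<Rightarrow> sample X t \<omega>) (of_nat n) \<partial>follmer_measure M A)
      = (\<integral>\<^sup>+\<omega>. min (sample X (\<rho> \<omega>) \<omega>) (of_nat n) \<partial>M)" for n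
  proof -
    have "(\<integral>\<^sup>+z. min (case z of (t, \<omega>) \<Rightarrow> sample X t \<omega>) (of_nat n) \<partial>follmer_measure M A)
        = (\<integral>\<^sup>+z. ennreal (case z of (t, \<omega>) \<Rightarrow> sample (Y n) t \<omega>) \<partial>follmer_measure M A)"
      by (simp add: mY case_prod_beta)
    also have "\<dots> = ennreal (\<integral>(t, \<omega>). sample (Y n) t \<omega> \<partial>follmer_measure M A)"
      using sY by (intro nn_integral_eq_integral \<mu>.integrable_const_bound[OF _ sY\<mu>, where B="real n"] AE_I2)
        (auto simp: case_prod_beta)
    also have "\<dots> = ennreal (\<integral>\<omega>. sample (Y n) (\<rho> \<omega>) \<omega> \<partial>M)"
      by (simp only: integral_sample_follmer_measure[OF Yopt Ybdd dual])
    also have "\<dots> = (\<integral>\<^sup>+\<omega>. ennreal (sample (Y n) (\<rho> \<omega>) \<omega>) \<partial>M)"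
      using sY by (intro nn_integral_eq_integral[symmetric] integrable_const_bound[OF _ sY\<rho>, where B="real n"] AE_I2) auto
    finally show ?thesis by (simp add: mY)
  qed
  have "(\<integral>\<^sup>+(t, \<omega>). sample X t \<omega> \<partial>follmer_measure M A)
      = (SUP n. \<integral>\<^sup>+z. min (case z of (t, \<omega>) \<Rightarrow> sample X t \<omega>) (of_nat n) \<partial>follmer_measure M A)"
    using sX\<mu> by (subst nn_integral_monotone_convergence_SUP[OF inc_min, symmetric]) (auto simp: SUP)
  also have "\<dots> = (SUP n. \<integral>\<^sup>+\<omega>. min (sample X (\<rho> \<omega>) \<omega>) (of_nat n) \<partial>M)"
    by (simp only: eq)
  also have "\<dots> = (\<integral>\<^sup>+\<omega>. sample X (\<rho> \<omega>) \<omega> \<partial>M)"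
    using sX\<rho> by (subst nn_integral_monotone_convergence_SUP[OF inc_min, symmetric]) (auto simp: SUP)
  finally show ?thesis .
qed

end

section \<open>Pseudo-stopping times and randomized stopping times\<close>

theorem proposition9:
  fixes M :: "'a measure" and F :: "real \<Rightarrow> 'a measure"
    and \<rho> :: "'a \<Rightarrow> ennreal" and A :: "real \<Rightarrow> 'a \<Rightarrow> real"
  assumes "usual_filtered_prob_space M F"
    and "pseudo_stopping_time M F \<rho>"
    and "measure M {\<omega> \<in> space M. \<rho> \<omega> = \<infinity>} = 0"
    and "dual_optional_projection M F \<rho> A"
  defines "\<mu> \<equiv> follmer_measure M A"
  shows "(\<forall>X :: ennreal \<times> 'a \<Rightarrow> ennreal. X \<in> borel_measurable (borel \<Otimes>\<^sub>M M) \<longrightarrow>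
            (\<integral>\<^sup>+z. X z \<partial>\<mu>) = (\<integral>\<^sup>+\<omega>. (\<integral>\<^sup>+s. X (ennreal s, \<omega>) \<partial>path_measure A \<omega>) \<partial>M)) \<and>
         (\<forall>X :: ennreal \<times> 'a \<Rightarrow> real. X \<in> borel_measurable (borel \<Otimes>\<^sub>M M) \<longrightarrow>
            (\<exists>K. \<forall>z\<in>UNIV \<times> space M. \<bar>X z\<bar> \<le> K) \<longrightarrow>
            (\<integral>z. X z \<partial>\<mu>) = (\<integral>\<omega>. (\<integral>s. X (ennreal s, \<omega>) \<partial>path_measure A \<omega>) \<partial>M)) \<and>
         randomized_stopping_time M F \<mu> \<and>
         (\<forall>X :: real \<Rightarrow> 'a \<Rightarrow> real. optional_process M F X \<longrightarrow> bounded_process M X \<longrightarrow>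
            (\<integral>(t, \<omega>). sample X t \<omega> \<partial>\<mu>) = (\<integral>\<omega>. sample X (\<rho> \<omega>) \<omega> \<partial>M)) \<and>
         (\<forall>X :: real \<Rightarrow> 'a \<Rightarrow> ennreal. optional_process M F X \<longrightarrow>
            (\<integral>\<^sup>+(t, \<omega>). sample X t \<omega> \<partial>\<mu>) = (\<integral>\<^sup>+\<omega>. sample X (\<rho> \<omega>) \<omega> \<partial>M))"
proof -
  interpret usual_filtered_prob_space M F by fact
  interpret unit_mass_process M F A
  proof
    show "increasing_process M A" "adapted F A"
      using assms(4) by (auto simp: dual_optional_projection_def)
    show "AE \<omega> in M. total_mass A \<omega> = 1"
      by (rule total_mass_eq_1[OF assms(2,3,4)])
  qed
  have \<rho>: "\<rho> \<in> borel_measurable M" using assms(2) by (simp add: pseudo_stopping_time_def)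
  show ?thesis
    unfolding \<mu>_def
  proof (intro conjI allI impI)
    fix X :: "ennreal \<times> 'a \<Rightarrow> real"
    assume X: "X \<in> borel_measurable (borel \<Otimes>\<^sub>M M)" and "\<exists>K. \<forall>z\<in>UNIV \<times> space M. \<bar>X z\<bar> \<le> K"
    then obtain K where "\<And>z. z \<in> UNIV \<times> space M \<Longrightarrow> \<bar>X z\<bar> \<le> K" by blast
    then show "(\<integral>z. X z \<partial>follmer_measure M A)
        = (\<integral>\<omega>. (\<integral>s. X (ennreal s, \<omega>) \<partial>path_measure A \<omega>) \<partial>M)"
      by (rule integral_follmer_measure[OF X])
  qed (auto intro: nn_integral_follmer_measure randomized_stopping_time_follmer_measure
        integral_sample_follmer_measure[OF _ _ assms(4)]
        nn_integral_sample_follmer_measure[OF _ \<rho> assms(4)])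
qed

end
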